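(* (Mean-field $XY$ model.) For every $\beta>0$, the function $\phi_\beta(x)=-\frac{\beta}{2}x^2+\log I_0(\beta x)$ attains its maximum on $[0,+\infty)$ at a unique point $r$, and the sequence of measures $(\mu_{n,\beta})_{n}$ converges weakly, as $n\to+\infty$, to $\eta_{\beta r}$.
   Context: Let $\mathbb{T}=\{z\in\mathbb{R}^2:\|z\|=1\}$ with the Euclidean distance and the Haar probability measure $\rho$, $\int_{\mathbb{T}}h\,d\rho=\int_{-\pi}^{\pi}h(\vec u_\theta)\frac{d\theta}{2\pi}$, $\vec u_\theta=(\cos\theta,\sin\theta)$. Let $\Omega=\mathbb{T}^{\mathbb{N}}$ with the product topology, $\mathbb{P}=\rho^{\otimes\mathbb{N}}$, and $\vec{\psi}:\Omega\to\mathbb{R}^2$, $\vec{\psi}(\omega)=\omega_0$. For $n\ge1$, the probabilistic Gibbs measure is $$\mu_{n,\beta}(d\omega)=\frac{1}{Z_{n,\beta}}\exp\Big(\frac{\beta}{2n}\Big\|\sum_{k=0}^{n-1}\omega_k\Big\|^2\Big)\,\mathbb{P}(d\omega),$$ with $Z_{n,\beta}$ the normalization factor making it a probability measure (writing $\omega_k=\vec u_{\theta_k}$, the exponent is $\frac{\beta}{2n}\sum_{i,j=0}^{n-1}\cos(\theta_i-\theta_j)$). $I_0(y)=\frac1\pi\int_0^\pi e^{y\cos\theta}\,d\theta$ is the modified Bessel function of order zero. For $t\in\mathbb{R}^2$, the transfer operator is $\mathcal{L}_{t\cdot\vec{\psi}}(f)(\omega)=\int_{-\pi}^{\pi}e^{t\cdot\vec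 u_\theta}f(\vec u_\theta\omega)\frac{d\theta}{2\pi}$, where $\vec u_\theta\omega$ denotes the sequence obtained by prepending $\vec u_\theta$ to $\omega$; its spectral radius on continuous functions is $I_0(\|t\|)$, with eigenfunction the constant $1$. The dynamical Gibbs measure $\mu_{t\cdot\vec{\psi}}$ (which here coincides with the conformal measure) is the unique probability measure on $\Omega$ with $\mathcal{L}_{t\cdot\vec{\psi}}^*\mu_{t\cdot\vec{\psi}}=I_0(\|t\|)\,\mu_{t\cdot\vec{\psi}}$. For $x\ge0$, $\eta_x$ is the probability measure on $\Omega$ defined by $\int_\Omega h\,d\eta_x=\frac{1}{2\pi}\int_{-\pi}^{\pi}\big[\int_\Omega h\,d\mu_{x\vec u_\theta\cdot\vec{\psi}}\big]d\theta$ for every bounded measurable $h$. Weak convergence means convergence of integrals of all continuous functions on $\Omega$. *)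

theory Defs
  imports "HOL-Probability.Probability"
begin

definition uvec :: "real \<Rightarrow> real^2" where
  "uvec \<theta> = vector [cos \<theta>, sin \<theta>]"

definition circle :: "(real^2) set" where
  "circle = sphere 0 1"

definition haar_circle :: "(real^2) measure" where
  "haar_circle =
     distr (uniform_measure lborel {-pi..pi}) (restrict_space borel circle) uvec"

text \<open>The configuration space is a subset of the function type, whose topology in the
  library is the product topology; it is the space of the measure \<open>PP\<close> below, whose
  \<open>\<sigma>\<close>-algebra is the Borel one because the product is countable.\<close>

definition Omega :: "(nat \<Rightarrow> real^2) set" where
  "Omega = (UNIV \<rightarrow> circle)"

definition PP :: "(nat \<Rightarrow> real^2) measure" where
  "PP = (\<Pi>\<^sub>M k\<in>UNIV. haar_circle)"

definition gibbs_weight :: "nat \<Rightarrow> real \<Rightarrow> (nat \<Rightarrow> real^2) \<Rightarrow> real" where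
  "gibbs_weight n \<beta> \<omega> = exp (\<beta> / (2 * real n) * (norm (\<Sum>k<n. \<omega> k))\<^sup>2)"

definition partition_fun :: "nat \<Rightarrow> real \<Rightarrow> real" where
  "partition_fun n \<beta> = (\<integral>\<omega>. gibbs_weight n \<beta> \<omega> \<partial>PP)"

text \<open>Meaningful for \<open>n \<ge> 1\<close>; since \<open>x / 0 = 0\<close>, the value at \<open>n = 0\<close> is \<open>PP\<close>.\<close>

definition prob_gibbs :: "nat \<Rightarrow> real \<Rightarrow> (nat \<Rightarrow> real^2) measure" where
  "prob_gibbs n \<beta> =
     density PP (\<lambda>\<omega>. ennreal (gibbs_weight n \<beta> \<omega> / partition_fun n \<beta>))"

definition bessel_I0 :: "real \<Rightarrow> real" where
  "bessel_I0 y = 1 / pi * (LBINT \<theta>:{0..pi}. exp (y * cos \<theta>))"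

definition phi :: "real \<Rightarrow> real \<Rightarrow> real" where
  "phi \<beta> x = - (\<beta> / 2) * x\<^sup>2 + ln (bessel_I0 (\<beta> * x))"

definition transfer_op ::
  "real^2 \<Rightarrow> ((nat \<Rightarrow> real^2) \<Rightarrow> real) \<Rightarrow> (nat \<Rightarrow> real^2) \<Rightarrow> real" where
  "transfer_op t f \<omega> =
     1 / (2 * pi) *
       (LBINT \<theta>:{-pi..pi}. exp (t \<bullet> uvec \<theta>) * f (case_nat (uvec \<theta>) \<omega>))"

text \<open>The adjoint of the transfer operator acts on measures, seen as functionals on the
  continuous functions on \<open>Omega\<close>.\<close>

definition is_dyn_gibbs :: "real^2 \<Rightarrow> (nat \<Rightarrow> real^2) measure \<Rightarrow> bool" where
  "is_dyn_gibbs t \<mu> \<longleftrightarrow>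
     prob_space \<mu> \<and> sets \<mu> = sets PP \<and>
     (\<forall>f. continuous_on Omega f \<longrightarrow>
        (\<integral>\<omega>. transfer_op t f \<omega> \<partial>\<mu>) = bessel_I0 (norm t) * (\<integral>\<omega>. f \<omega> \<partial>\<mu>))"

definition dyn_gibbs :: "real^2 \<Rightarrow> (nat \<Rightarrow> real^2) measure" where
  "dyn_gibbs t = (THE \<mu>. is_dyn_gibbs t \<mu>)"

definition is_eta :: "real \<Rightarrow> (nat \<Rightarrow> real^2) measure \<Rightarrow> bool" where
  "is_eta x \<nu> \<longleftrightarrow>
     prob_space \<nu> \<and> sets \<nu> = sets PP \<and>
     (\<forall>h \<in> borel_measurable PP. (\<exists>B. \<forall>\<omega>\<in>Omega. \<bar>h \<omega>\<bar> \<le> (B::real)) \<longrightarrow>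
        (\<integral>\<omega>. h \<omega> \<partial>\<nu>) =
          1 / (2 * pi) *
            (LBINT \<theta>:{-pi..pi}. (\<integral>\<omega>. h \<omega> \<partial>(dyn_gibbs (x *\<^sub>R uvec \<theta>)))))"

definition eta :: "real \<Rightarrow> (nat \<Rightarrow> real^2) measure" where
  "eta x = (THE \<nu>. is_eta x \<nu>)"

definition weakly_converges ::
  "(nat \<Rightarrow> (nat \<Rightarrow> real^2) measure) \<Rightarrow> (nat \<Rightarrow> real^2) measure \<Rightarrow> bool" where
  "weakly_converges M N \<longleftrightarrow>
     (\<forall>h :: (nat \<Rightarrow> real^2) \<Rightarrow> real. continuous_on Omega h \<longrightarrow>
        (\<lambda>n. \<integral>\<omega>. h \<omega> \<partial>(M n)) \<longlonglongrightarrow> (\<integral>\<omega>. h \<omega> \<partial>N))"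

end

theory Submission
  imports Defs
begin

text \<open>
  Completing the square in a Gaussian integral over the plane (Hubbard--Stratonovich) turns the
  mean-field weight into a mixture of independent spins in an external field \<open>\<beta> x\<close>:
  for \<open>h\<close> depending on the first \<open>n\<close> spins, \<open>\<integral> h d\<mu>\<^sub>n\<close> is the average of
  \<open>\<integral> h d\<mu>\<^bsub>\<beta> x \<cdot> \<psi>\<^esub>\<close> over \<open>x\<close> with weight \<open>exp (n \<phi>\<^sub>\<beta>(norm x))\<close>, where the dynamical Gibbs
  measure is the product of the tilted laws \<open>e\<^bsup>\<beta> x \<cdot> u\<^esup> d\<rho>(u) / I\<^sub>0\<close>. Rotation invariance
  replaces the integrand by its circular average, which is a continuous function of \<open>norm x\<close>,
  and Laplace's principle concentrates the weight on the circle of radius \<open>r\<close>. The maximiser \<open>r\<close>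
  is unique because \<open>I\<^sub>1(y) / (y I\<^sub>0(y))\<close> is strictly decreasing, so \<open>\<phi>\<^sub>\<beta>\<close> has at most one
  positive critical point. Uniform approximation by functions of finitely many spins (\<open>\<Omega>\<close> is
  compact) extends the convergence to all continuous functions.
\<close>

subsection \<open>The Bessel function and the maximiser of \<open>\<phi>\<^sub>\<beta>\<close>\<close>

text \<open>\<open>dyn_gibbs\<close> and \<open>eta\<close> are definite descriptions, so both need
  existence and uniqueness before anything can be computed. Dividing the eigenmeasure equation by
  I_0 says that prepending an independent tilted spin leaves the measure invariant; iterating this
  fixes the mass of every cylinder. Existence of \<open>eta\<close> requires the product measures to
  depend measurably on the field.

  Product measures for distinct fields are mutually singular, so continuity in the field and the
  exchange with the Gaussian integral are carried out only for functions of finitely many spins,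
  where the field enters through an exponential under the single measure \<open>PP\<close>.

  The Gaussian constant is never evaluated: the case h = 1 of the same identity gives the partition
  function, and the constant cancels. No critical value of \<beta> is computed either: r = 0 and r >
  0 are covered by the same argument, since two maximisers would force two positive critical
  points.\<close>

definition bessel_moment :: "nat \<Rightarrow> real \<Rightarrow> real" where
  "bessel_moment k y = integral {0..pi} (\<lambda>\<theta>. cos \<theta> ^ k * exp (y * cos \<theta>))"

lemma bessel_I0_eq_moment: "bessel_I0 y = bessel_moment 0 y / pi"
proof -
  have "set_integrable lborel {0..pi} (\<lambda>\<theta>. exp (y * cos \<theta>))"
    by (intro borel_integrable_atLeastAtMost') (auto intro!: continuous_intros)
  then show ?thesis
    by (simp add: bessel_I0_def bessel_moment_def set_borel_integral_eq_integral(2))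
qed

lemma bessel_moment_integrable: "(\<lambda>\<theta>. cos \<theta> ^ k * exp (y * cos \<theta>)) integrable_on {0..pi}"
  by (intro integrable_continuous_real continuous_intros)

lemma DERIV_bessel_moment: "DERIV (bessel_moment k) y :> bessel_moment (Suc k) y"
proof -
  have "((\<lambda>y. integral (cbox 0 pi) (\<lambda>\<theta>. cos \<theta> ^ k * exp (y * cos \<theta>))) has_field_derivative
      integral (cbox 0 pi) (\<lambda>\<theta>. cos \<theta> ^ Suc k * exp (y * cos \<theta>))) (at y within UNIV)"
  proof (rule leibniz_rule_field_derivative)
    show "((\<lambda>x. cos t ^ k * exp (x * cos t)) has_field_derivative cos t ^ Suc k * exp (x * cos t))
        (at x within UNIV)" for x t :: real
      by (auto intro!: derivative_eq_intros)
    show "continuous_on (UNIV \<times> cbox 0 pi) (\<lambda>(x, t). cos t ^ Suc k * exp (x * cos t))"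
      unfolding case_prod_unfold by (intro continuous_intros)
  qed (use bessel_moment_integrable in \<open>auto\<close>)
  then show ?thesis
    by (simp add: bessel_moment_def [abs_def])
qed

lemmas DERIV_bessel_moment_0_1 =
  DERIV_bessel_moment[of 0, folded One_nat_def]
  DERIV_bessel_moment[of 1, unfolded Suc_1]

text \<open>This is the modified Bessel equation y I_0'' + I_0' = y I_0 up to the factor pi, since
  \<open>bessel_moment k\<close> is pi times the k-th derivative of I_0. It comes from integrating
  the derivative of sin \<theta> exp(y cos \<theta>), which vanishes at both endpoints.\<close>

lemma bessel_ode: "y * bessel_moment 2 y = y * bessel_moment 0 y - bessel_moment 1 y"
proof -
  let ?f = "\<lambda>k \<theta>. cos \<theta> ^ k * exp (y * cos \<theta>)"
  have "((\<lambda>\<theta>. cos \<theta> * exp (y * cos \<theta>) - y * (sin \<theta>)\<^sup>2 * exp (y * cos \<theta>)) has_integral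
      (sin pi * exp (y * cos pi) - sin 0 * exp (y * cos 0))) {0..pi}"
    by (rule fundamental_theorem_of_calculus)
       (auto intro!: derivative_eq_intros simp: power2_eq_square algebra_simps
         simp flip: has_real_derivative_iff_has_vector_derivative)
  moreover have "cos \<theta> * exp (y * cos \<theta>) - y * (sin \<theta>)\<^sup>2 * exp (y * cos \<theta>)
      = ?f 1 \<theta> - y * ?f 0 \<theta> + y * ?f 2 \<theta>" for \<theta>
    by (simp add: sin_squared_eq algebra_simps)
  ultimately have "((\<lambda>\<theta>. ?f 1 \<theta> - y * ?f 0 \<theta> + y * ?f 2 \<theta>) has_integral 0) {0..pi}"
    by simp
  moreover have "((\<lambda>\<theta>. ?f 1 \<theta> - y * ?f 0 \<theta> + y * ?f 2 \<theta>) has_integral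
     (bessel_moment 1 y - y * bessel_moment 0 y + y * bessel_moment 2 y)) {0..pi}"
    unfolding bessel_moment_def
    by (intro has_integral_add has_integral_diff has_integral_mult_right integrable_integral
        bessel_moment_integrable)
  ultimately have "bessel_moment 1 y - y * bessel_moment 0 y + y * bessel_moment 2 y = 0"
    using has_integral_unique by blast
  then show ?thesis by simp
qed

lemma bessel_moment_0_pos: "bessel_moment 0 y > 0"
proof -
  have "integral {0..pi} (\<lambda>\<theta>::real. 0::real) < bessel_moment 0 y"
    unfolding bessel_moment_def
    by (intro integral_less_real) (use pi_gt_zero in \<open>auto intro!: continuous_intros simp del: pi_gt_zero\<close>)
  then show ?thesis by simp
qed

lemma bessel_I0_pos: "bessel_I0 y > 0"
  by (simp add: bessel_I0_eq_moment bessel_moment_0_pos)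

lemma bessel_moment_2_less: "bessel_moment 2 y < bessel_moment 0 y"
  unfolding bessel_moment_def
proof (intro integral_less_real)
  fix \<theta> :: real assume "\<theta> \<in> {0<..<pi}"
  then have "sin \<theta> > 0" by (simp add: sin_gt_zero)
  then have "(cos \<theta>)\<^sup>2 < 1"
    by (simp add: cos_squared_eq)
  then show "(cos \<theta>)\<^sup>2 * exp (y * cos \<theta>) < cos \<theta> ^ 0 * exp (y * cos \<theta>)"
    by simp
qed (use pi_gt_zero in \<open>auto intro!: continuous_intros simp del: pi_gt_zero\<close>)

text \<open>The integrand changes sign at pi/2; the Bessel equation replaces it by y (sin
  \<theta>)^2 exp(y cos \<theta>), which does not.\<close>

lemma bessel_moment_1_pos:
  assumes "y > 0"
  shows "bessel_moment 1 y > 0"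
proof -
  have "bessel_moment 1 y = y * (bessel_moment 0 y - bessel_moment 2 y)"
    using bessel_ode[of y] by (simp add: algebra_simps)
  then show ?thesis
    using assms bessel_moment_2_less[of y] by simp
qed

lemma bessel_I0_le_exp: "bessel_I0 y \<le> exp \<bar>y\<bar>"
proof -
  have "bessel_moment 0 y \<le> integral {0..pi} (\<lambda>\<theta>. exp \<bar>y\<bar>)"
    unfolding bessel_moment_def
  proof (intro integral_le bessel_moment_integrable)
    fix \<theta> :: real
    have "y * cos \<theta> \<le> \<bar>y * cos \<theta>\<bar>" by simp
    also have "\<dots> \<le> \<bar>y\<bar>" by (simp add: abs_mult mult_left_le)
    finally show "cos \<theta> ^ 0 * exp (y * cos \<theta>) \<le> exp \<bar>y\<bar>" by simp
  qed auto
  then show ?thesis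
    by (simp add: bessel_I0_eq_moment field_simps)
qed

lemma bessel_I0_0 [simp]: "bessel_I0 0 = 1"
  by (simp add: bessel_I0_eq_moment bessel_moment_def)

text \<open>The left-hand side vanishes at \<open>0\<close> and, by the Bessel equation, its derivative is
  \<open>- 2 y I\<^sub>1(y)\<^sup>2\<close> up to the factor \<open>\<pi>\<^sup>2\<close>.\<close>

lemma bessel_turan:
  assumes "y > 0"
  shows "y\<^sup>2 * (bessel_moment 0 y)\<^sup>2 - 2 * y * bessel_moment 0 y * bessel_moment 1 y
      - y\<^sup>2 * (bessel_moment 1 y)\<^sup>2 < 0"
proof -
  define G where "G y = y\<^sup>2 * (bessel_moment 0 y)\<^sup>2 - 2 * y * bessel_moment 0 y * bessel_moment 1 y
      - y\<^sup>2 * (bessel_moment 1 y)\<^sup>2" for y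
  have D: "DERIV G z :> - 2 * z * (bessel_moment 1 z)\<^sup>2" for z
  proof -
    have "DERIV G z :> (2 * z * (bessel_moment 0 z)\<^sup>2
        + z\<^sup>2 * (2 * bessel_moment 0 z * bessel_moment 1 z)
        - (2 * bessel_moment 0 z * bessel_moment 1 z + 2 * z * (bessel_moment 1 z)\<^sup>2
            + 2 * bessel_moment 0 z * (z * bessel_moment 2 z))
        - (2 * z * (bessel_moment 1 z)\<^sup>2 + 2 * z * bessel_moment 1 z * (z * bessel_moment 2 z)))"
      unfolding G_def
      by (rule derivative_eq_intros DERIV_bessel_moment_0_1 refl)+
         (simp add: power2_eq_square algebra_simps)
    then show ?thesis
      unfolding bessel_ode by (simp add: power2_eq_square algebra_simps)
  qed
  have "G y < G 0"
  proof (rule DERIV_neg_imp_decreasing_open[OF assms])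
    fix x :: real assume "0 < x"
    then show "\<exists>d. DERIV G x :> d \<and> d < 0"
      using D[of x] bessel_moment_1_pos[of x] by (intro exI conjI) auto
  qed (auto intro!: continuous_at_imp_continuous_on DERIV_isCont D)
  then show ?thesis
    by (simp add: G_def)
qed

text \<open>The quotient is shaped so that z > 0 is a critical point of \<open>phi \<beta>\<close>
  exactly when \<open>bessel_quot (\<beta> * z) = 1 / \<beta>\<close>.\<close>

definition bessel_quot :: "real \<Rightarrow> real" where
  "bessel_quot y = bessel_moment 1 y / (y * bessel_moment 0 y)"

lemma bessel_quot_strict_antimono:
  assumes "0 < y" "y < z"
  shows "bessel_quot z < bessel_quot y"
proof (rule DERIV_neg_imp_decreasing[OF assms(2)])
  fix x assume "y \<le> x"
  with assms have x: "x > 0" by simp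
  note pos = bessel_moment_0_pos[of x]
  let ?N = "(x * bessel_moment 2 x) * bessel_moment 0 x
       - bessel_moment 1 x * (bessel_moment 0 x + x * bessel_moment 1 x)"
  have "DERIV bessel_quot x :> ?N / (x * bessel_moment 0 x)\<^sup>2"
    unfolding bessel_quot_def using x pos
    by (auto intro!: derivative_eq_intros DERIV_bessel_moment_0_1 simp: power2_eq_square simp del: One_nat_def)
  \<comment> \<open>Eliminating the second moment by the Bessel equation turns x times the numerator
    into exactly the expression of \<open>bessel_turan\<close>.\<close>
  moreover have "x * ?N < 0"
    unfolding bessel_ode using bessel_turan[OF x] by (simp add: power2_eq_square algebra_simps)
  then have "?N < 0"
    using x by (simp add: mult_less_0_iff)
  then have "?N / (x * bessel_moment 0 x)\<^sup>2 < 0"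
    using x pos by (intro divide_neg_pos) auto
  ultimately show "\<exists>d. DERIV bessel_quot x :> d \<and> d < 0"
    by blast
qed

section \<open>Critical points and maximisers of phi\<close>

lemma DERIV_phi:
  "DERIV (phi \<beta>) x :> - \<beta> * x + \<beta> * bessel_moment 1 (\<beta> * x) / bessel_moment 0 (\<beta> * x)"
  unfolding phi_def bessel_I0_eq_moment using bessel_moment_0_pos[of "\<beta> * x"]
  by (auto intro!: derivative_eq_intros DERIV_chain2[OF DERIV_bessel_moment])

text \<open>Dividing the critical equation by \<beta>^2 z leaves an equation for the injective
  function \<open>bessel_quot\<close>. Positivity cannot be dropped: 0 is always a critical point,
  because the first moment vanishes there.\<close>

lemma phi_critical_point_unique:
  assumes "\<beta> > 0" "0 < x" "0 < y" "DERIV (phi \<beta>) x :> 0" "DERIV (phi \<beta>) y :> 0"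
  shows "x = y"
proof -
  have "bessel_quot (\<beta> * z) = 1 / \<beta>" if "0 < z" "DERIV (phi \<beta>) z :> 0" for z
  proof -
    have "- \<beta> * z + \<beta> * bessel_moment 1 (\<beta> * z) / bessel_moment 0 (\<beta> * z) = 0"
      using DERIV_unique[OF DERIV_phi that(2)] .
    then show ?thesis
      using that assms(1) bessel_moment_0_pos[of "\<beta> * z"]
      by (simp add: bessel_quot_def field_simps)
  qed
  then have "bessel_quot (\<beta> * x) = bessel_quot (\<beta> * y)"
    using assms by simp
  then show ?thesis
    using bessel_quot_strict_antimono[of "\<beta> * x" "\<beta> * y"]
      bessel_quot_strict_antimono[of "\<beta> * y" "\<beta> * x"] assms
    by (cases x y rule: linorder_cases) auto
qed

lemma continuous_on_phi: "continuous_on S (phi \<beta>)"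
  by (intro continuous_at_imp_continuous_on ballI DERIV_isCont[OF DERIV_phi])

lemma phi_0 [simp]: "phi \<beta> 0 = 0"
  by (simp add: phi_def)

lemma phi_le:
  assumes "\<beta> > 0" "x \<ge> 0"
  shows "phi \<beta> x \<le> - (\<beta> / 2) * x\<^sup>2 + \<beta> * x"
proof -
  have "ln (bessel_I0 (\<beta> * x)) \<le> ln (exp \<bar>\<beta> * x\<bar>)"
    using bessel_I0_le_exp bessel_I0_pos by (subst ln_le_cancel_iff) auto
  then show ?thesis
    using assms by (simp add: phi_def abs_mult)
qed

text \<open>With x at least 2 and x - 2 at least 2/\<beta>, the bound (\<beta>/2) x (x - 2) is at
  least 2. Any negative level would do, because the maximum is at least
  \<open>phi \<beta> 0 = 0\<close>.\<close>

lemma phi_le_neg_one: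
  assumes "\<beta> > 0" "x \<ge> 2 + 2 / \<beta>"
  shows "phi \<beta> x \<le> - 1"
proof -
  have x: "x \<ge> 0" using assms by (smt (verit) divide_nonneg_pos)
  have "phi \<beta> x \<le> - (\<beta> / 2) * x\<^sup>2 + \<beta> * x"
    using phi_le[OF assms(1) x] .
  also have "\<dots> = - (\<beta> / 2 * x * (x - 2))"
    by (simp add: power2_eq_square field_simps)
  also have "\<dots> \<le> - (\<beta> / 2 * 2 * (2 / \<beta>))"
    using assms x by (intro le_imp_neg_le mult_mono) (auto, smt (verit) divide_nonneg_pos)
  also have "\<dots> \<le> -1" using assms by simp
  finally show ?thesis .
qed

text \<open>Two maximisers a < b have equal values, so Rolle gives a critical point strictly between
  them, and b > 0 is itself critical as an interior maximum. These are two positive critical points,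
  even when a = 0.\<close>

lemma phi_arg_max_unique:
  assumes \<beta>: "\<beta> > 0" and s: "0 \<le> s" "\<And>y. y \<ge> 0 \<Longrightarrow> phi \<beta> y \<le> phi \<beta> s"
    and r: "0 \<le> r" "\<And>y. y \<ge> 0 \<Longrightarrow> phi \<beta> y \<le> phi \<beta> r"
  shows "s = r"
proof -
  have crit: "DERIV (phi \<beta>) z :> 0" if "z > 0" "\<And>y. y \<ge> 0 \<Longrightarrow> phi \<beta> y \<le> phi \<beta> z" for z
  proof -
    have "- \<beta> * z + \<beta> * bessel_moment 1 (\<beta> * z) / bessel_moment 0 (\<beta> * z) = 0"
      \<comment> \<open>The radius \<open>z\<close> keeps the neighbourhood inside the half-line on
        which maximality is known.\<close>
      using that by (intro DERIV_local_max[OF DERIV_phi, of z]) auto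
    then show ?thesis using DERIV_phi[of \<beta> z] by simp
  qed
  have False if "a < b" "0 \<le> a" "\<And>y. y \<ge> 0 \<Longrightarrow> phi \<beta> y \<le> phi \<beta> a"
    "\<And>y. y \<ge> 0 \<Longrightarrow> phi \<beta> y \<le> phi \<beta> b" for a b
  proof -
    have "\<exists>z>a. z < b \<and> DERIV (phi \<beta>) z :> 0"
      using that by (intro Rolle continuous_on_phi)
        (auto intro!: antisym DERIV_phi simp: real_differentiable_def)
    then obtain z where z: "a < z" "z < b" "DERIV (phi \<beta>) z :> 0" by blast
    then show False
      using phi_critical_point_unique[OF \<beta>, of z b] crit[of b] that by auto
  qed
  then show ?thesis
    using s r by (cases s r rule: linorder_cases) blast+
qed

lemma phi_max_exists:
  assumes "\<beta> > 0"
  shows "\<exists>r\<ge>0. \<forall>y\<ge>0. phi \<beta> y \<le> phi \<beta> r"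
proof -
  define R where "R = 2 + 2 / \<beta>"
  have "R \<ge> 0" using assms by (simp add: R_def)
  then obtain r where r: "r \<in> {0..R}" "\<And>y. y \<in> {0..R} \<Longrightarrow> phi \<beta> y \<le> phi \<beta> r"
    using continuous_attains_sup[of "{0..R}" "phi \<beta>"] continuous_on_phi by fastforce
  have "phi \<beta> y \<le> phi \<beta> r" if "y \<ge> 0" for y
  proof (cases "y \<le> R")
    case False
    then have "phi \<beta> y \<le> phi \<beta> 0"
      using phi_le_neg_one[OF assms, of y] by (simp add: R_def)
    then show ?thesis using r(2)[of 0] \<open>R \<ge> 0\<close> by simp
  qed (use r that in auto)
  then show ?thesis using r by auto
qed

text \<open>Uniqueness of the maximiser and compactness give a gap \<open>c\<close> on the part of
  [0,R] away from r. Beyond R the values are at most -1 while the maximum is nonnegative, so there a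
  gap of 1 is available; hence \<open>min c 1\<close>.\<close>

lemma phi_near_max:
  assumes \<beta>: "\<beta> > 0" and r: "0 \<le> r" "\<And>y. y \<ge> 0 \<Longrightarrow> phi \<beta> y \<le> phi \<beta> r" and \<delta>: "\<delta> > 0"
  shows "\<exists>c>0. \<forall>y\<ge>0. phi \<beta> y > phi \<beta> r - c \<longrightarrow> \<bar>y - r\<bar> < \<delta>"
proof -
  define R where "R = 2 + 2 / \<beta>"
  define K where "K = {0..R} - ball r \<delta>"
  have r0: "phi \<beta> r \<ge> 0" using r(2)[of 0] by simp
  have *: "\<exists>c>0. \<forall>y\<in>K. phi \<beta> y \<le> phi \<beta> r - c"
  proof (cases "K = {}")
    case True
    then show ?thesis by (auto intro: exI[of _ 1])
  next
    case False
    have "compact K" unfolding K_def by (intro compact_diff) auto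
    then obtain z where z: "z \<in> K" "\<And>y. y \<in> K \<Longrightarrow> phi \<beta> y \<le> phi \<beta> z"
      using continuous_attains_sup[of K "phi \<beta>"] False continuous_on_phi by blast
    have "z \<noteq> r" "z \<ge> 0" using z \<delta> by (auto simp: K_def)
    have "phi \<beta> z \<noteq> phi \<beta> r"
      using phi_arg_max_unique[OF \<beta> \<open>z \<ge> 0\<close> _ r] r(2) \<open>z \<noteq> r\<close> by auto
    then have "phi \<beta> z < phi \<beta> r" using r(2)[OF \<open>z \<ge> 0\<close>] by simp
    then show ?thesis
      using z(2) by (intro exI[of _ "phi \<beta> r - phi \<beta> z"]) auto
  qed
  then obtain c where c: "c > 0" "\<And>y. y \<in> K \<Longrightarrow> phi \<beta> y \<le> phi \<beta> r - c" by blast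
  have "\<bar>y - r\<bar> < \<delta>" if "y \<ge> 0" "phi \<beta> y > phi \<beta> r - min c 1" for y
  proof (rule ccontr)
    assume far: "\<not> \<bar>y - r\<bar> < \<delta>"
    show False
    proof (cases "y \<le> R")
      case True
      then have "y \<in> K" using far that by (auto simp: K_def dist_real_def)
      then show False using c(2)[of y] that by auto
    next
      case False
      then show False
        using phi_le_neg_one[OF \<beta>, of y] r0 that by (auto simp: R_def)
    qed
  qed
  then show ?thesis using c(1) by (intro exI[of _ "min c 1"]) auto
qed

subsection \<open>Laplace's principle and Gaussian integrals\<close>

text \<open>Bounding n - 1 of the n factors exp(V) by exp(M) leaves a single integrable one.\<close>

lemma integrable_exp_scaled:
  fixes V :: "'a::euclidean_space \<Rightarrow> real"
  assumes V: "continuous_on UNIV V" and int: "integrable lborel (\<lambda>x. exp (V x))"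
    and M: "\<And>x. V x \<le> M" and n: "n > 0"
  shows "integrable lborel (\<lambda>x. exp (real n * V x))"
proof (rule Bochner_Integration.integrable_bound[OF integrable_mult_right[OF int, of "exp (real (n - 1) * M)"]])
  have [measurable]: "V \<in> borel_measurable borel"
    using V by (rule borel_measurable_continuous_onI)
  show "(\<lambda>x. exp (real n * V x)) \<in> borel_measurable lborel" by measurable
  have "real n * V x = real (n - 1) * V x + V x" for x
    using n by (simp add: of_nat_diff algebra_simps)
  then show "AE x in lborel. norm (exp (real n * V x)) \<le> norm (exp (real (n - 1) * M) * exp (V x))"
    using M by (simp add: mult_left_mono flip: exp_add)
qed

text \<open>The hypothesis on \<open>G\<close> asks for closeness to \<open>L\<close> wherever V is
  nearly maximal, not near one point, so the set of maximisers may be a whole circle. Where V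
  exceeds M - c the error is at most e/2; elsewhere the weight is exponentially smaller than the
  denominator.\<close>

lemma laplace_concentration:
  fixes V G :: "'a::euclidean_space \<Rightarrow> real"
  assumes V: "continuous_on UNIV V" and int: "integrable lborel (\<lambda>x. exp (V x))"
    and x0: "V x0 = M" and M: "\<And>x. V x \<le> M"
    and G [measurable]: "G \<in> borel_measurable borel" and B: "\<And>x. \<bar>G x\<bar> \<le> B"
    and conc: "\<And>\<epsilon>. \<epsilon> > 0 \<Longrightarrow> \<exists>c>0. \<forall>x. V x > M - c \<longrightarrow> \<bar>G x - L\<bar> \<le> \<epsilon>"
  shows "(\<lambda>n. (\<integral>x. exp (real n * V x) * G x \<partial>lborel) / (\<integral>x. exp (real n * V x) \<partial>lborel)) \<longlonglongrightarrow> L"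
proof -
  have [measurable]: "V \<in> borel_measurable borel"
    using V by (rule borel_measurable_continuous_onI)
  define D where "D n = (\<integral>x. exp (real n * V x) \<partial>lborel)" for n :: nat
  have split: "real n * V x = real (n - 1) * V x + V x" if "n > 0" for n x
    using that by (simp add: of_nat_diff algebra_simps)
  note intn = integrable_exp_scaled[OF V int M]
  have "\<forall>\<^sub>F n in sequentially. \<bar>(\<integral>x. exp (real n * V x) * G x \<partial>lborel) / D n - L\<bar> < e" if "e > 0" for e
  proof -
    have "\<exists>c>0. \<forall>x. V x > M - c \<longrightarrow> \<bar>G x - L\<bar> \<le> e / 2"
      using that by (intro conc) simp
    then obtain c where c: "c > 0" "\<And>x. V x > M - c \<Longrightarrow> \<bar>G x - L\<bar> \<le> e / 2"
      by metis
    \<comment> \<open>Half of the gap is kept: a ball on which V exceeds M - c/2 makes the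
      denominator at least of order exp(n (M - c/2)), which beats the tail of order exp(n (M -
      c)).\<close>
    have "open {x. M - c / 2 < V x}"
      using V by (intro open_Collect_less continuous_on_const) auto
    then obtain \<rho> where \<rho>: "\<rho> > 0" "ball x0 \<rho> \<subseteq> {x. M - c / 2 < V x}"
      using x0 c(1) openE[of "{x. M - c / 2 < V x}" x0] by auto
    define v where "v = measure lborel (ball x0 \<rho>)"
    have v: "v > 0"
      unfolding v_def using \<rho>(1) content_ball_pos by simp
    define K where "K = (B + \<bar>L\<bar>) * D 1"
    have D_lower: "exp (real n * (M - c / 2)) * v \<le> D n" if "n > 0" for n
    proof -
      have "(\<integral>x. exp (real n * (M - c / 2)) * indicator (ball x0 \<rho>) x \<partial>lborel) \<le> D n"
        unfolding D_def
      proof (intro integral_mono intn[OF that])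
        show "exp (real n * (M - c / 2)) * indicator (ball x0 \<rho>) x \<le> exp (real n * V x)" for x
        proof (cases "x \<in> ball x0 \<rho>")
          case True
          then have "M - c / 2 \<le> V x" using \<rho>(2) by auto
          then show ?thesis
            unfolding indicator_simps(1)[OF True] by (simp add: mult_left_mono)
        qed simp
      qed (auto intro!: integrable_mult_right integrable_real_indicator emeasure_lborel_ball_finite)
      then show ?thesis by (simp add: v_def)
    qed
    have bound: "\<bar>(\<integral>x. exp (real n * V x) * G x \<partial>lborel) / D n - L\<bar>
        \<le> e / 2 + K / v * exp (c - M) * exp (- (c / 2)) ^ n" if n: "n > 0" for n
    proof -
      have Dn: "D n > 0"
        using D_lower[OF n] v by (smt (verit) exp_gt_zero mult_pos_pos)
      have intG: "integrable lborel (\<lambda>x. exp (real n * V x) * G x)"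
        by (rule Bochner_Integration.integrable_bound[OF integrable_mult_left[OF intn[OF n], of B]])
           (auto simp: abs_mult intro!: mult_left_mono order_trans[OF B])
      have intL: "integrable lborel (\<lambda>x. exp (real n * V x) * \<bar>G x - L\<bar>)"
      proof -
        have "integrable lborel (\<lambda>x. \<bar>exp (real n * V x) * G x - exp (real n * V x) * L\<bar>)"
          using intG intn[OF n] by (intro integrable_abs Bochner_Integration.integrable_diff integrable_mult_left) auto
        then show ?thesis
          by (simp add: abs_mult flip: right_diff_distrib)
      qed
      have "\<bar>(\<integral>x. exp (real n * V x) * G x \<partial>lborel) - L * D n\<bar>
          = \<bar>\<integral>x. exp (real n * V x) * (G x - L) \<partial>lborel\<bar>"
      proof -
        have "exp (real n * V x) * (G x - L) = exp (real n * V x) * G x - L * exp (real n * V x)" for x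
          by (simp add: algebra_simps)
        then show ?thesis
          unfolding D_def using intG intn[OF n] by (simp add: Bochner_Integration.integral_diff)
      qed
      also have "\<dots> \<le> (\<integral>x. exp (real n * V x) * \<bar>G x - L\<bar> \<partial>lborel)"
        using integral_norm_bound[of lborel "\<lambda>x. exp (real n * V x) * (G x - L)"]
        by (simp add: abs_mult)
      \<comment> \<open>The first summand covers the region V > M - c, the second its complement.
        One factor exp(V x) is retained in the second to keep it integrable over the whole
        space.\<close>
      also have "\<dots> \<le> (\<integral>x. exp (real n * V x) * (e / 2)
          + exp (real (n - 1) * (M - c)) * (B + \<bar>L\<bar>) * exp (V x) \<partial>lborel)"
      proof (intro integral_mono intL Bochner_Integration.integrable_add integrable_mult_left
          integrable_mult_right intn[OF n] int)
        fix x
        show "exp (real n * V x) * \<bar>G x - L\<bar> \<le> exp (real n * V x) * (e / 2)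
          + exp (real (n - 1) * (M - c)) * (B + \<bar>L\<bar>) * exp (V x)"
        proof (cases "V x > M - c")
          case True
          have "B \<ge> 0" using B[of x] by simp
          then show ?thesis
            using c(2)[OF True] by (intro add_increasing2 mult_left_mono) auto
        next
          case False
          have "\<bar>G x - L\<bar> \<le> B + \<bar>L\<bar>" using B[of x] by simp
          moreover have "exp (real n * V x) \<le> exp (real (n - 1) * (M - c)) * exp (V x)"
            using False by (simp add: split[OF n] mult_left_mono flip: exp_add)
          ultimately have "exp (real n * V x) * \<bar>G x - L\<bar>
              \<le> exp (real (n - 1) * (M - c)) * exp (V x) * (B + \<bar>L\<bar>)"
            by (intro mult_mono) auto
          then show ?thesis
            using \<open>e > 0\<close> by (intro add_increasing) (auto simp: mult_ac)
        qed
      qed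
      also have "\<dots> = e / 2 * D n + K * exp (real (n - 1) * (M - c))"
        unfolding D_def K_def using int intn[OF n]
        by (simp add: Bochner_Integration.integral_add mult_ac)
      finally have *: "\<bar>(\<integral>x. exp (real n * V x) * G x \<partial>lborel) - L * D n\<bar>
          \<le> e / 2 * D n + K * exp (real (n - 1) * (M - c))" .
      have "B \<ge> 0" using B[of x0] by simp
      have K: "K \<ge> 0"
        unfolding K_def D_def using \<open>B \<ge> 0\<close> by (intro mult_nonneg_nonneg Bochner_Integration.integral_nonneg) auto
      have "\<bar>(\<integral>x. exp (real n * V x) * G x \<partial>lborel) / D n - L\<bar>
          = \<bar>(\<integral>x. exp (real n * V x) * G x \<partial>lborel) - L * D n\<bar> / D n"
        using Dn by (simp add: abs_divide [symmetric, of _ "D n", unfolded abs_of_pos[OF Dn]] diff_divide_distrib)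
      also have "\<dots> \<le> (e / 2 * D n + K * exp (real (n - 1) * (M - c))) / D n"
        using * Dn by (simp add: divide_right_mono)
      also have "\<dots> = e / 2 + K * exp (real (n - 1) * (M - c)) / D n"
        using Dn by (simp add: add_divide_distrib)
      also have "\<dots> \<le> e / 2 + K * exp (real (n - 1) * (M - c)) / (exp (real n * (M - c / 2)) * v)"
        using D_lower[OF n] v K by (intro add_left_mono divide_left_mono mult_nonneg_nonneg mult_pos_pos Dn) auto
      also have "K * exp (real (n - 1) * (M - c)) / (exp (real n * (M - c / 2)) * v)
          = K / v * exp (c - M) * exp (- (c / 2)) ^ n"
      proof -
        have "exp (real (n - 1) * (M - c)) = exp (c - M) * exp (- (c / 2)) ^ n * exp (real n * (M - c / 2))"
          unfolding exp_of_nat_mult[symmetric] exp_add[symmetric]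
          using n by (simp add: of_nat_diff algebra_simps)
        then show ?thesis using v by simp
      qed
      finally show ?thesis by simp
    qed
    have "(\<lambda>n. e / 2 + K / v * exp (c - M) * exp (- (c / 2)) ^ n) \<longlonglongrightarrow> e / 2 + K / v * exp (c - M) * 0"
      using c(1) by (intro tendsto_intros LIMSEQ_power_zero) auto
    then have "\<forall>\<^sub>F n in sequentially. e / 2 + K / v * exp (c - M) * exp (- (c / 2)) ^ n < e"
      by (rule order_tendstoD(2)) (use that in simp)
    with eventually_gt_at_top[of 0] show ?thesis
      by eventually_elim (rule le_less_trans[OF bound])
  qed
  then show ?thesis
    unfolding D_def by (intro tendstoI) (simp add: dist_real_def)
qed

section \<open>Gaussian integrals and the rotation invariance of Lebesgue measure\<close>

lemma integrable_gaussian: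
  assumes "a > 0"
  shows "integrable lborel (\<lambda>x::'a::euclidean_space. exp (- (a * (norm x)\<^sup>2)))"
proof -
  \<comment> \<open>The standard deviation for which y^2 / (2 \<sigma>^2) equals a y^2; the
    one-dimensional case is then a multiple of a normal density, and the general one factors over
    the basis.\<close>
  define \<sigma> where "\<sigma> = 1 / sqrt (2 * a)"
  have \<sigma>: "\<sigma> > 0" "\<sigma>\<^sup>2 = 1 / (2 * a)"
    using assms by (auto simp: \<sigma>_def power_divide)
  have "integrable lborel (\<lambda>y. sqrt (2 * pi * \<sigma>\<^sup>2) * normal_density 0 \<sigma> y)"
    using \<sigma> integrable_normal_density by (intro integrable_mult_right) auto
  moreover have "sqrt (2 * pi * \<sigma>\<^sup>2) * normal_density 0 \<sigma> y = exp (- (a * y\<^sup>2))" for y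
    using assms \<sigma> by (simp add: normal_density_def field_simps)
  ultimately have "integrable lborel (\<lambda>y. exp (- (a * y\<^sup>2)))"
    by simp
  then have fin: "(\<integral>\<^sup>+y. ennreal (exp (- (a * y\<^sup>2))) \<partial>lborel) < \<infinity>"
    by (simp add: integrable_iff_bounded)
  have "exp (- (a * (norm x)\<^sup>2)) = (\<Prod>b\<in>Basis. exp (- (a * (x \<bullet> b)\<^sup>2)))" for x :: 'a
    by (simp add: norm_eq_sqrt_inner euclidean_inner[of x x] sum_nonneg exp_sum[symmetric] sum_distrib_left
        sum_negf power2_eq_square)
  then have "(\<integral>\<^sup>+x. ennreal (exp (- (a * (norm (x::'a))\<^sup>2))) \<partial>lborel)
      = (\<integral>\<^sup>+x. (\<Prod>b\<in>(Basis::'a set). ennreal (exp (- (a * (x \<bullet> b)\<^sup>2)))) \<partial>lborel)"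
    by (simp add: prod_ennreal)
  also have "\<dots> = (\<Prod>b\<in>(Basis :: 'a set). \<integral>\<^sup>+y. ennreal (exp (- (a * y\<^sup>2))) \<partial>lborel)"
    by (rule nn_integral_lborel_prod) auto
  also have "\<dots> < \<infinity>"
    using fin by (simp add: power_less_top_ennreal)
  finally show ?thesis
    by (simp add: integrable_iff_bounded)
qed

text \<open>Half of the quadratic term absorbs the linear one, by expanding (a r - b)^2 \<ge> 0 and
  dividing by 2 a.\<close>

lemma integrable_gaussian_linear:
  assumes "a > 0"
  shows "integrable lborel (\<lambda>x::'a::euclidean_space. exp (- (a * (norm x)\<^sup>2) + b * norm x))"
proof (rule Bochner_Integration.integrable_bound)
  show "integrable lborel (\<lambda>x::'a. exp (b\<^sup>2 / (2 * a)) * exp (- (a / 2 * (norm x)\<^sup>2)))"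
    using assms by (intro integrable_mult_right integrable_gaussian) simp
  have "- (a * r\<^sup>2) + b * r \<le> b\<^sup>2 / (2 * a) - a / 2 * r\<^sup>2" for r
  proof -
    have "0 \<le> (a * r - b)\<^sup>2 / (2 * a)" using assms by simp
    then show ?thesis using assms by (simp add: power2_eq_square field_simps)
  qed
  then show "AE x in lborel. norm (exp (- (a * (norm x)\<^sup>2) + b * norm x))
      \<le> norm (exp (b\<^sup>2 / (2 * a)) * exp (- (a / 2 * (norm (x::'a))\<^sup>2)))"
    by (simp flip: exp_add)
qed simp

text \<open>Translating the integration variable by s / a completes the square.\<close>

lemma hubbard_stratonovich:
  fixes s :: "'a::euclidean_space"
  assumes "a > 0"
  shows "(\<integral>x. exp (- (a / 2 * (norm x)\<^sup>2) + x \<bullet> s) \<partial>lborel)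
     = exp ((norm s)\<^sup>2 / (2 * a)) * (\<integral>x. exp (- (a / 2 * (norm (x::'a))\<^sup>2)) \<partial>lborel)"
proof -
  have sq: "- (a / 2 * (norm (s /\<^sub>R a + x))\<^sup>2) + (s /\<^sub>R a + x) \<bullet> s
      = (norm s)\<^sup>2 / (2 * a) + - (a / 2 * (norm x)\<^sup>2)" for x :: 'a
    using assms unfolding power2_norm_eq_inner
    by (simp add: inner_add_left inner_add_right inner_commute field_simps)
  have "(\<integral>x. exp (- (a / 2 * (norm x)\<^sup>2) + x \<bullet> s) \<partial>lborel)
      = (\<integral>x. exp (- (a / 2 * (norm x)\<^sup>2) + x \<bullet> s) \<partial>distr lborel borel ((+) (s /\<^sub>R a)))"
    by (simp add: lborel_distr_plus)
  also have "\<dots> = (\<integral>x. exp (- (a / 2 * (norm (s /\<^sub>R a + x))\<^sup>2) + (s /\<^sub>R a + x) \<bullet> s) \<partial>lborel)"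
    by (rule integral_distr) auto
  also have "\<dots> = exp ((norm s)\<^sup>2 / (2 * a)) * (\<integral>x. exp (- (a / 2 * (norm (x::'a))\<^sup>2)) \<partial>lborel)"
    unfolding sq exp_add by simp
  finally show ?thesis .
qed

text \<open>The preimage of a box is its image under the inverse \<open>g\<close>, and orthogonal
  images preserve Lebesgue measure. That preimage is Borel, which allows passing between
  \<open>lebesgue\<close> and \<open>lborel\<close>.\<close>

lemma lborel_distr_orthogonal_transformation:
  fixes f :: "real^'n::{finite,wellorder} \<Rightarrow> real^'n::_"
  assumes f: "orthogonal_transformation f"
  shows "distr lborel borel f = lborel"
proof (rule lborel_eqI[symmetric])
  have lin: "linear f" using f by (rule orthogonal_transformation_linear)
  then have [measurable]: "f \<in> borel_measurable borel"
    by (intro borel_measurable_continuous_onI linear_continuous_on linear_conv_bounded_linear[THEN iffD1])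
  fix l u :: "real^'n::_" assume le: "\<And>b. b \<in> Basis \<Longrightarrow> l \<bullet> b \<le> u \<bullet> b"
  obtain g where g: "orthogonal_transformation g" "\<And>x. g (f x) = x" "\<And>x. f (g x) = x"
    by (metis bij_inv_eq_iff f orthogonal_transformation_bij orthogonal_transformation_inv)
  then have eq: "f -` box l u = g ` box l u" by (auto simp: image_iff) (metis g(2))
  have box: "box l u \<in> lmeasurable" by simp
  have gm: "g ` box l u \<in> lmeasurable" using g(1) box by (rule measurable_orthogonal_image)
  have "emeasure (distr lborel borel f) (box l u) = emeasure lborel (g ` box l u)"
    by (simp add: emeasure_distr eq)
  also have "g ` box l u \<in> sets borel"
    unfolding eq[symmetric] by (metis \<open>f \<in> borel_measurable borel\<close> borel_open open_box space_borel measurable_sets Int_UNIV_right)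
  then have "emeasure lborel (g ` box l u) = emeasure lebesgue (g ` box l u)"
    by simp
  also have "\<dots> = ennreal (measure lebesgue (g ` box l u))"
    using gm by (metis emeasure_eq_ennreal_measure fmeasurableD2 infinity_ennreal_def)
  also have "measure lebesgue (g ` box l u) = measure lebesgue (box l u)"
    using g(1) box by (rule measure_orthogonal_image)
  also have "\<dots> = (\<Prod>b\<in>Basis. (u - l) \<bullet> b)"
    using le by (simp add: content_cbox' measure_lborel_box_eq)
  finally show "emeasure (distr lborel borel f) (box l u) = ennreal (\<Prod>b\<in>Basis. (u - l) \<bullet> b)" .
qed simp

subsection \<open>Averages over the circle\<close>

lemma uvec_nth [simp]: "uvec \<theta> $ 1 = cos \<theta>" "uvec \<theta> $ 2 = sin \<theta>"
  by (simp_all add: uvec_def)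

lemma norm_real2: "norm (x::real^2) = sqrt ((x $ 1)\<^sup>2 + (x $ 2)\<^sup>2)"
  by (simp add: norm_vec_def L2_set_def UNIV_2)

lemma inner_real2: "(x::real^2) \<bullet> y = x $ 1 * y $ 1 + x $ 2 * y $ 2"
  by (simp add: inner_vec_def UNIV_2)

lemma norm_uvec [simp]: "norm (uvec \<theta>) = 1"
  by (simp add: norm_real2)

lemma uvec_in_circle [simp]: "uvec \<theta> \<in> circle"
  by (simp add: circle_def)

lemma uvec_inner: "uvec \<alpha> \<bullet> uvec \<theta> = cos (\<theta> - \<alpha>)"
  by (simp add: inner_real2 cos_diff mult.commute)

lemma uvec_periodic [simp]: "uvec (\<theta> + 2 * pi) = uvec \<theta>"
  by (simp add: uvec_def)

lemma continuous_on_uvec [continuous_intros]: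
  fixes f :: "'a::t2_space \<Rightarrow> real"
  assumes "continuous_on S f"
  shows "continuous_on S (\<lambda>x. uvec (f x))"
proof -
  have "uvec \<theta> = (\<chi> i. if i = 1 then cos \<theta> else sin \<theta>)" for \<theta>
    by (simp add: vec_eq_iff forall_2)
  moreover have "continuous_on S (\<lambda>x. \<chi> i. if i = (1::2) then cos (f x) else sin (f x))"
  proof (rule continuous_on_vec_lambda)
    show "continuous_on S (\<lambda>x. if i = (1::2) then cos (f x) else sin (f x))" for i
      by (cases "i = 1") (auto intro!: continuous_intros assms)
  qed
  ultimately show ?thesis by simp
qed

lemma borel_measurable_uvec [measurable]: "uvec \<in> borel_measurable borel"
  by (intro borel_measurable_continuous_onI continuous_intros)

lemma polar_real2: "\<exists>\<theta>. x = norm x *\<^sub>R uvec \<theta>" for x :: "real^2"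
proof (cases "x = 0")
  case False
  then have "(x $ 1 / norm x)\<^sup>2 + (x $ 2 / norm x)\<^sup>2 = 1"
    by (simp add: power_divide add_divide_distrib[symmetric]) (simp add: norm_real2)
  then obtain \<theta> where "x $ 1 / norm x = cos \<theta>" "x $ 2 / norm x = sin \<theta>"
    by (metis sincos_total_2pi)
  then have "x $ 1 = norm x * cos \<theta>" "x $ 2 = norm x * sin \<theta>"
    using False by (metis nonzero_eq_divide_eq mult.commute norm_eq_zero)+
  then have "x = norm x *\<^sub>R uvec \<theta>"
    unfolding vec_eq_iff forall_2 by simp
  then show ?thesis ..
qed simp

definition rotation :: "real \<Rightarrow> real^2 \<Rightarrow> real^2" where
  "rotation \<alpha> x = vector [cos \<alpha> * x $ 1 - sin \<alpha> * x $ 2, sin \<alpha> * x $ 1 + cos \<alpha> * x $ 2]"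

lemma rotation_uvec: "rotation \<alpha> (s *\<^sub>R uvec \<theta>) = s *\<^sub>R uvec (\<theta> + \<alpha>)"
  by (simp add: rotation_def vec_eq_iff forall_2 cos_add sin_add algebra_simps)

lemma orthogonal_transformation_rotation: "orthogonal_transformation (rotation \<alpha>)"
proof -
  have "linear (rotation \<alpha>)"
    by (rule linearI) (simp_all add: rotation_def vec_eq_iff forall_2 algebra_simps)
  moreover have "norm (rotation \<alpha> x) = norm x" for x
    using polar_real2[of x] by (metis rotation_uvec norm_scaleR norm_uvec)
  ultimately show ?thesis by (simp add: orthogonal_transformation)
qed

lemma norm_rotation [simp]: "norm (rotation \<alpha> x) = norm x"
  using orthogonal_transformation_rotation orthogonal_transformation by blast

text \<open>With an antiderivative g, the integral shifted by a is g(a + pi) - g(a - pi); its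
  derivative in a vanishes by periodicity, so the shifts \<alpha> and 0 give the same value.\<close>

lemma integral_periodic_shift:
  fixes p :: "real \<Rightarrow> real"
  assumes cont: "continuous_on UNIV p" and per: "\<And>x. p (x + 2 * pi) = p x"
  shows "integral {-pi..pi} (\<lambda>\<theta>. p (\<theta> + \<alpha>)) = integral {-pi..pi} p"
proof -
  \<comment> \<open>The extra 1 puts both shifts strictly inside (-R,R), where g has two-sided
    derivatives at all points needed.\<close>
  define R where "R = \<bar>\<alpha>\<bar> + 1"
  obtain g where g: "\<And>x. x \<in> {-(R + pi)..R + pi} \<Longrightarrow>
      (g has_vector_derivative p x) (at x within {-(R + pi)..R + pi})"
    using antiderivative_continuous[of "-(R + pi)" "R + pi" p] cont continuous_on_subset
    by (metis subset_UNIV)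
  have g': "(g has_real_derivative p x) (at x)" if "\<bar>x\<bar> < R + pi" for x
  proof -
    have "at x within {-(R + pi)..R + pi} = at x"
      using that by (intro at_within_interior) (auto simp: abs_less_iff)
    then show ?thesis
      using g[of x] that by (auto simp: has_real_derivative_iff_has_vector_derivative abs_less_iff)
  qed
  have int: "integral {-pi..pi} (\<lambda>\<theta>. p (\<theta> + a)) = g (pi + a) - g (a - pi)" if "\<bar>a\<bar> < R" for a
  proof (rule integral_unique)
    have "((\<lambda>\<theta>. p (\<theta> + a)) has_integral (g (pi + a) - g (- pi + a))) {-pi..pi}"
    proof (rule fundamental_theorem_of_calculus)
      fix x assume "x \<in> {- pi..pi}"
      then have "\<bar>x + a\<bar> < R + pi" using that by auto
      then have "((\<lambda>\<theta>. g (\<theta> + a)) has_real_derivative p (x + a)) (at x)"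
        using DERIV_shift g' by blast
      then show "((\<lambda>\<theta>. g (\<theta> + a)) has_vector_derivative p (x + a)) (at x within {- pi..pi})"
        using has_real_derivative_iff_has_vector_derivative has_vector_derivative_at_within by blast
    qed simp
    then show "((\<lambda>\<theta>. p (\<theta> + a)) has_integral (g (pi + a) - g (a - pi))) {-pi..pi}"
      by simp
  qed
  have "\<exists>c. \<forall>x\<in>{-R<..<R}. g (pi + x) - g (x - pi) = c"
  proof (rule has_field_derivative_zero_constant)
    fix x assume x: "x \<in> {-R<..<R}"
    have "((\<lambda>x. g (pi + x) - g (x - pi)) has_real_derivative p (pi + x) * 1 - p (x - pi) * 1) (at x)"
      using x pi_gt_zero by (intro derivative_intros DERIV_chain2[OF g'])
        (auto intro!: derivative_eq_intros simp: abs_less_iff simp del: pi_gt_zero)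
    moreover have "p (pi + x) = p (x - pi)"
      using per[of "x - pi"] by (simp add: add.commute)
    ultimately show "((\<lambda>x. g (pi + x) - g (x - pi)) has_real_derivative 0) (at x within {-R<..<R})"
      by (simp add: has_field_derivative_at_within)
  qed simp
  then obtain c where c: "\<And>x. x \<in> {-R<..<R} \<Longrightarrow> g (pi + x) - g (x - pi) = c" by blast
  have "R > \<bar>\<alpha>\<bar>" "R > 0" by (auto simp: R_def)
  then show ?thesis
    using int[of \<alpha>] int[of 0] c[of \<alpha>] c[of 0] by (auto simp: abs_less_iff)
qed

text \<open>Integration against \<rho>, kept in angular form so that it matches the formulas in
  \<open>transfer_op\<close> and \<open>is_eta\<close> literally.\<close>

definition circle_avg :: "(real^2 \<Rightarrow> real) \<Rightarrow> real" where
  "circle_avg f = 1 / (2 * pi) * (LBINT \<theta>:{-pi..pi}. f (uvec \<theta>))"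

lemma circle_avg_eq_integral:
  assumes "continuous_on UNIV (\<lambda>\<theta>. f (uvec \<theta>))"
  shows "circle_avg f = 1 / (2 * pi) * integral {-pi..pi} (\<lambda>\<theta>. f (uvec \<theta>))"
proof -
  have "set_integrable lborel {-pi..pi} (\<lambda>\<theta>. f (uvec \<theta>))"
    by (intro borel_integrable_atLeastAtMost' continuous_on_subset[OF assms]) auto
  then show ?thesis
    by (simp add: circle_avg_def set_borel_integral_eq_integral(2))
qed

text \<open>In polar form, rotating x by \<theta> adds \<theta> to its angle, and the initial angle
  is removed by periodicity.\<close>

lemma circle_avg_rotation:
  assumes "continuous_on UNIV f"
  shows "1 / (2 * pi) * (LBINT \<theta>:{-pi..pi}. f (rotation \<theta> x)) = circle_avg (\<lambda>u. f (norm x *\<^sub>R u))"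
proof -
  obtain \<alpha> where \<alpha>: "x = norm x *\<^sub>R uvec \<alpha>" using polar_real2 by blast
  define s where "s = norm x"
  have cont: "continuous_on S (\<lambda>\<theta>. f (s *\<^sub>R uvec (\<theta> + c)))" for c S
    by (intro continuous_on_compose2[OF assms]) (auto intro!: continuous_intros)
  have x: "f (rotation \<theta> x) = f (s *\<^sub>R uvec (\<theta> + \<alpha>))" for \<theta>
    using \<alpha> rotation_uvec[of \<theta> s \<alpha>] by (simp add: s_def add.commute)
  have "set_integrable lborel {-pi..pi} (\<lambda>\<theta>. f (s *\<^sub>R uvec (\<theta> + \<alpha>)))"
    by (intro borel_integrable_atLeastAtMost' cont)
  then have "(LBINT \<theta>:{-pi..pi}. f (rotation \<theta> x)) = integral {-pi..pi} (\<lambda>\<theta>. f (s *\<^sub>R uvec (\<theta> + \<alpha>)))"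
    by (simp add: x set_borel_integral_eq_integral(2))
  also have "\<dots> = integral {-pi..pi} (\<lambda>\<theta>. f (s *\<^sub>R uvec \<theta>))"
    using cont[of UNIV 0] by (intro integral_periodic_shift) auto
  finally show ?thesis
    using cont[of UNIV 0] by (subst circle_avg_eq_integral) (auto simp: s_def)
qed

text \<open>The exponent is norm t times cos(\<theta> - \<alpha>), where \<alpha> is the angle of t.
  A periodic shift removes \<alpha>, and evenness folds the integral onto [0,pi]. This is why I_0 of
  the norm normalises \<open>field_measure\<close>.\<close>

lemma circle_avg_exp: "circle_avg (\<lambda>u. exp (t \<bullet> u)) = bessel_I0 (norm t)"
proof -
  obtain \<alpha> where \<alpha>: "t = norm t *\<^sub>R uvec \<alpha>" using polar_real2 by blast
  define y where "y = norm t"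
  let ?f = "\<lambda>\<theta>. exp (y * cos \<theta>)"
  have int: "?f integrable_on {a..b}" for a b
    by (intro integrable_continuous_real continuous_intros)
  have "exp (t \<bullet> uvec \<theta>) = ?f (\<theta> + - \<alpha>)" for \<theta>
    using \<alpha> by (metis inner_scaleR_left uvec_inner y_def diff_conv_add_uminus)
  then have "circle_avg (\<lambda>u. exp (t \<bullet> u)) = 1 / (2 * pi) * integral {-pi..pi} (\<lambda>\<theta>. ?f (\<theta> + - \<alpha>))"
    by (subst circle_avg_eq_integral) (auto intro!: continuous_intros)
  also have "integral {-pi..pi} (\<lambda>\<theta>. ?f (\<theta> + - \<alpha>)) = integral {-pi..pi} ?f"
    by (intro integral_periodic_shift) (auto intro!: continuous_intros)
  also have "\<dots> = integral {-pi..0} ?f + integral {0..pi} ?f"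
    using int by (intro Henstock_Kurzweil_Integration.integral_combine[symmetric]) auto
  also have "integral {-pi..0} ?f = integral {0..pi} ?f"
    using Henstock_Kurzweil_Integration.integral_reflect_real[where a=0 and b=pi and f="?f"] by simp
  finally show ?thesis
    by (simp add: bessel_I0_eq_moment bessel_moment_def y_def)
qed

subsection \<open>Dynamical Gibbs measures\<close>

lemma emeasure_angle_interval: "emeasure lborel {-pi..pi} = ennreal (2 * pi)"
  by simp

lemma prob_space_uniform_angle: "prob_space (uniform_measure lborel {-pi..pi})"
  by (intro prob_space_uniform_measure) auto

lemma integral_uniform_angle:
  fixes f :: "real \<Rightarrow> real"
  assumes [measurable]: "f \<in> borel_measurable borel"
  shows "(\<integral>\<theta>. f \<theta> \<partial>uniform_measure lborel {-pi..pi}) = 1 / (2 * pi) * (LBINT \<theta>:{-pi..pi}. f \<theta>)"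
proof -
  have "uniform_measure lborel {-pi..pi} = density lborel (\<lambda>x. ennreal (indicator {-pi..pi} x / (2 * pi)))"
    unfolding uniform_measure_def emeasure_angle_interval
    by (intro density_cong) (auto simp: indicator_def divide_ennreal simp flip: ennreal_1)
  then have "(\<integral>\<theta>. f \<theta> \<partial>uniform_measure lborel {-pi..pi})
      = (\<integral>\<theta>. indicator {-pi..pi} \<theta> / (2 * pi) * f \<theta> \<partial>lborel)"
    by (simp add: integral_density)
  also have "\<dots> = (\<integral>\<theta>. 1 / (2 * pi) * (indicator {-pi..pi} \<theta> * f \<theta>) \<partial>lborel)"
    by (intro Bochner_Integration.integral_cong) auto
  finally show ?thesis
    by (simp add: set_lebesgue_integral_def)
qed

lemma sets_haar_circle [measurable_cong]: "sets haar_circle = sets (restrict_space borel circle)"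
  by (simp add: haar_circle_def)

lemma space_haar_circle [simp]: "space haar_circle = circle"
  by (simp add: haar_circle_def space_restrict_space)

lemma measurable_uvec_circle [measurable]: "uvec \<in> borel \<rightarrow>\<^sub>M restrict_space borel circle"
  by (intro measurable_restrict_space2) auto

lemma measurable_haar_borel: "(\<lambda>u. u) \<in> haar_circle \<rightarrow>\<^sub>M borel"
  unfolding measurable_cong_sets[OF sets_haar_circle refl]
  by (rule measurable_restrict_space1) simp

lemma prob_space_haar_circle: "prob_space haar_circle"
  unfolding haar_circle_def
  by (intro prob_space.prob_space_distr prob_space_uniform_angle)
     (simp add: measurable_uvec_circle cong: measurable_cong_sets)

lemma integral_haar_circle:
  fixes f :: "real^2 \<Rightarrow> real"
  assumes f: "f \<in> borel_measurable haar_circle"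
  shows "(\<integral>u. f u \<partial>haar_circle) = circle_avg f"
proof -
  have f': "f \<in> borel_measurable (restrict_space borel circle)"
    using f by (simp cong: measurable_cong_sets add: sets_haar_circle)
  have "(\<integral>u. f u \<partial>haar_circle) = (\<integral>\<theta>. f (uvec \<theta>) \<partial>uniform_measure lborel {-pi..pi})"
    unfolding haar_circle_def
    by (intro integral_distr f') (simp add: measurable_uvec_circle cong: measurable_cong_sets)
  also have "\<dots> = circle_avg f"
    unfolding circle_avg_def
    by (intro integral_uniform_angle measurable_compose[OF measurable_uvec_circle f'])
  finally show ?thesis .
qed

definition field_measure :: "real^2 \<Rightarrow> (real^2) measure" where
  "field_measure t = density haar_circle (\<lambda>u. ennreal (exp (t \<bullet> u) / bessel_I0 (norm t)))"

definition field_product :: "real^2 \<Rightarrow> (nat \<Rightarrow> real^2) measure" where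
  "field_product t = (\<Pi>\<^sub>M k\<in>UNIV. field_measure t)"

lemma measurable_inner_haar: "(\<lambda>u. t \<bullet> u) \<in> borel_measurable haar_circle"
  by (intro measurable_compose[OF measurable_haar_borel, of "\<lambda>u. t \<bullet> u"]) simp

lemma sets_field_measure: "sets (field_measure t) = sets haar_circle"
  by (simp add: field_measure_def)

lemma space_field_measure [simp]: "space (field_measure t) = circle"
  by (simp add: field_measure_def)

lemma integral_field_measure:
  fixes f :: "real^2 \<Rightarrow> real"
  assumes "f \<in> borel_measurable haar_circle"
  shows "bessel_I0 (norm t) * (\<integral>u. f u \<partial>field_measure t) = (\<integral>u. exp (t \<bullet> u) * f u \<partial>haar_circle)"
proof -
  note [measurable] = measurable_inner_haar assms
  have "(\<integral>u. f u \<partial>field_measure t) = (\<integral>u. (exp (t \<bullet> u) / bessel_I0 (norm t)) *\<^sub>R f u \<partial>haar_circle)"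
    unfolding field_measure_def using bessel_I0_pos
    by (intro integral_density) (auto intro!: AE_I2 divide_nonneg_pos)
  then have "(\<integral>u. f u \<partial>field_measure t)
      = (\<integral>u. (exp (t \<bullet> u) * f u) / bessel_I0 (norm t) \<partial>haar_circle)"
    by simp
  then show ?thesis
    using bessel_I0_pos[of "norm t"] by simp
qed

lemma abs_inner_circle_le: "u \<in> circle \<Longrightarrow> \<bar>t \<bullet> u\<bar> \<le> norm t"
  using Cauchy_Schwarz_ineq2[of t u] by (simp add: circle_def)

lemma prob_space_field_measure: "prob_space (field_measure t)"
proof (rule prob_spaceI)
  interpret prob_space haar_circle by (rule prob_space_haar_circle)
  note [measurable] = measurable_inner_haar
  have "integrable haar_circle (\<lambda>u. exp (t \<bullet> u) / bessel_I0 (norm t))"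
    using bessel_I0_pos[of "norm t"] abs_inner_circle_le[of _ t]
    by (intro integrable_const_bound[where B="exp (norm t) / bessel_I0 (norm t)"] AE_I2)
       (auto intro!: divide_right_mono simp: abs_le_iff)
  then have "(\<integral>\<^sup>+u. ennreal (exp (t \<bullet> u) / bessel_I0 (norm t)) \<partial>haar_circle)
      = ennreal (\<integral>u. exp (t \<bullet> u) / bessel_I0 (norm t) \<partial>haar_circle)"
    using bessel_I0_pos[of "norm t"] by (intro nn_integral_eq_integral) auto
  moreover have "emeasure (field_measure t) (space (field_measure t))
      = (\<integral>\<^sup>+u. ennreal (exp (t \<bullet> u) / bessel_I0 (norm t)) \<partial>haar_circle)"
    unfolding field_measure_def
    using sets.top[of haar_circle] by (subst emeasure_density) (auto intro!: nn_integral_cong)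
  ultimately have "emeasure (field_measure t) (space (field_measure t))
      = ennreal (\<integral>u. exp (t \<bullet> u) / bessel_I0 (norm t) \<partial>haar_circle)"
    by simp
  also have "(\<integral>u. exp (t \<bullet> u) / bessel_I0 (norm t) \<partial>haar_circle) = 1"
    using bessel_I0_pos[of "norm t"] circle_avg_exp[of t] by (simp add: integral_haar_circle)
  finally show "emeasure (field_measure t) (space (field_measure t)) = 1" by simp
qed

lemma sequence_space_field_measure: "sequence_space (field_measure t)"
  unfolding sequence_space_def by (intro product_prob_spaceI prob_space_field_measure)

lemma sequence_space_haar_circle: "sequence_space haar_circle"
  unfolding sequence_space_def by (intro product_prob_spaceI prob_space_haar_circle)

lemma prob_space_PP: "prob_space PP"
  unfolding PP_def by (intro prob_space_PiM prob_space_haar_circle)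

lemma prob_space_field_product: "prob_space (field_product t)"
  unfolding field_product_def by (intro prob_space_PiM prob_space_field_measure)

lemma sets_field_product: "sets (field_product t) = sets PP"
  unfolding field_product_def PP_def by (intro sets_PiM_cong sets_field_measure refl)

section \<open>Borel structure and compactness of the configuration space\<close>

lemma Omega_eq_PiE: "Omega = PiE UNIV (\<lambda>_. circle)"
  by (simp add: Omega_def PiE_UNIV_domain)

lemma space_PP [simp]: "space PP = Omega"
  by (simp add: PP_def space_PiM Omega_eq_PiE)

lemma space_eq_Omega: "sets M = sets PP \<Longrightarrow> space M = Omega"
  by (metis sets_eq_imp_space_eq space_PP)

lemma measurable_coordinate: "(\<lambda>\<omega>. \<omega> k) \<in> PP \<rightarrow>\<^sub>M haar_circle"
  unfolding PP_def by measurable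

lemma measurable_coordinate_borel [measurable]: "(\<lambda>\<omega>. \<omega> k) \<in> PP \<rightarrow>\<^sub>M borel"
  using measurable_compose[OF measurable_coordinate measurable_haar_borel] .

text \<open>Each inclusion is the measurability of the identity map in one direction. The equality
  is what makes functions continuous on \<open>Omega\<close> measurable for the product
  measures.\<close>

lemma sets_PP: "sets PP = sets (restrict_space borel Omega)"
proof
  have "(\<lambda>\<omega>. \<omega>) \<in> PP \<rightarrow>\<^sub>M (\<Pi>\<^sub>M k\<in>UNIV. borel)"
    by (rule measurable_PiM_single') auto
  then have "(\<lambda>\<omega>. \<omega>) \<in> PP \<rightarrow>\<^sub>M borel"
    by (simp cong: measurable_cong_sets add: sets_PiM_equal_borel)
  then have "(\<lambda>\<omega>. \<omega>) \<in> PP \<rightarrow>\<^sub>M restrict_space borel Omega"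
    by (intro measurable_restrict_space2) auto
  from measurable_sets[OF this] show "sets (restrict_space borel Omega) \<subseteq> sets PP"
    using sets.sets_into_space[where M="restrict_space borel Omega"]
    by (fastforce simp: space_restrict_space Int_absorb2)
  have "(\<lambda>\<omega>. \<omega> k) \<in> restrict_space borel Omega \<rightarrow>\<^sub>M restrict_space borel circle" for k
    by (intro measurable_restrict_space3) (auto simp: Omega_def intro!: measurable_product_coordinates)
  then have "(\<lambda>\<omega>. \<omega> k) \<in> restrict_space borel Omega \<rightarrow>\<^sub>M haar_circle" for k
    by (simp cong: measurable_cong_sets add: sets_haar_circle)
  then have "(\<lambda>\<omega>. \<omega>) \<in> restrict_space borel Omega \<rightarrow>\<^sub>M PP"
    unfolding PP_def
    by (intro measurable_PiM_single') (auto simp: space_restrict_space Omega_def)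
  from measurable_sets[OF this] show "sets PP \<subseteq> sets (restrict_space borel Omega)"
    using sets.sets_into_space[where M=PP] by (auto simp: space_restrict_space Int_absorb2)
qed

lemma measurable_PP_of_continuous:
  fixes h :: "(nat \<Rightarrow> real^2) \<Rightarrow> real"
  shows "continuous_on Omega h \<Longrightarrow> h \<in> borel_measurable PP"
  using borel_measurable_continuous_on_restrict[of Omega h]
  by (simp cong: measurable_cong_sets add: sets_PP)

lemma compact_Omega: "compact Omega"
proof -
  have "compactin (product_topology (\<lambda>i::nat. euclidean) UNIV) (PiE UNIV (\<lambda>_. circle))"
    unfolding compactin_PiE by (simp add: circle_def)
  then show ?thesis
    by (simp add: euclidean_product_topology Omega_eq_PiE)
qed

lemma bounded_of_continuous:
  fixes h :: "(nat \<Rightarrow> real^2) \<Rightarrow> real"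
  assumes "continuous_on Omega h"
  shows "\<exists>B. \<forall>\<omega>\<in>Omega. \<bar>h \<omega>\<bar> \<le> B"
proof -
  have "bounded (h ` Omega)"
    by (intro compact_imp_bounded compact_continuous_image assms compact_Omega)
  then show ?thesis by (auto simp: bounded_iff)
qed

lemma integrable_bounded_PP:
  fixes h :: "(nat \<Rightarrow> real^2) \<Rightarrow> real"
  assumes "prob_space M" "sets M = sets PP" "h \<in> borel_measurable PP"
    and "\<And>\<omega>. \<omega> \<in> Omega \<Longrightarrow> \<bar>h \<omega>\<bar> \<le> B"
  shows "integrable M h"
proof -
  interpret prob_space M by fact
  show ?thesis
    using assms by (intro integrable_const_bound[where B=B] AE_I2)
      (auto simp: space_eq_Omega cong: measurable_cong_sets)
qed

text \<open>Indicators of closed sets are limits of continuous functions with values in [0,1], and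
  closed sets form an intersection-stable generator of the Borel sets.\<close>

lemma measure_eqI_continuous:
  assumes M: "prob_space M" "sets M = sets PP" and N: "prob_space N" "sets N = sets PP"
    and eq: "\<And>f::_ \<Rightarrow> real. continuous_on Omega f \<Longrightarrow> (\<integral>\<omega>. f \<omega> \<partial>M) = (\<integral>\<omega>. f \<omega> \<partial>N)"
  shows "M = N"
proof -
  interpret M: prob_space M by fact
  interpret N: prob_space N by fact
  have id_PP: "(\<lambda>\<omega>. \<omega>) \<in> PP \<rightarrow>\<^sub>M borel"
    unfolding measurable_cong_sets[OF sets_PP refl] by (rule measurable_restrict_space1) simp
  then have [measurable]: "(\<lambda>\<omega>. \<omega>) \<in> M \<rightarrow>\<^sub>M borel" "(\<lambda>\<omega>. \<omega>) \<in> N \<rightarrow>\<^sub>M borel"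
    using M N by (simp_all cong: measurable_cong_sets)
  note space = space_eq_Omega[OF M(2)] space_eq_Omega[OF N(2)]
  have closed_eq: "measure M (C \<inter> Omega) = measure N (C \<inter> Omega)" if C: "closed C" for C
  \<comment> \<open>The empty set is treated apart: \<open>infdist\<close> to it is 0 by convention,
    so the functions below would be constantly 1.\<close>
  proof (cases "C = {}")
    case False
    define f where "f n \<omega> = max 0 (1 - real n * infdist \<omega> C)" for n :: nat and \<omega>
    have f: "continuous_on Omega (f n)" for n
      unfolding f_def by (intro continuous_intros)
    have f_bound: "\<bar>f n \<omega>\<bar> \<le> 1" for n \<omega>
      by (auto simp: f_def infdist_nonneg)
    have f_lim: "(\<lambda>n. f n \<omega>) \<longlonglongrightarrow> indicator C \<omega>" for \<omega>
    proof (cases "\<omega> \<in> C")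
      case False
      then have d: "infdist \<omega> C > 0"
        using C \<open>C \<noteq> {}\<close> by (simp add: infdist_pos_not_in_closed)
      obtain m where m: "1 / infdist \<omega> C \<le> real m" using real_arch_simple by blast
      have "f n \<omega> = 0" if "n \<ge> m" for n
      proof -
        have "1 / infdist \<omega> C \<le> real n" using m that by linarith
        then show ?thesis using d by (simp add: f_def field_simps)
      qed
      then show ?thesis
        using False by (intro tendsto_eventually) (auto simp: eventually_sequentially)
    qed (simp add: f_def infdist_zero)
    have lim: "(\<lambda>n. \<integral>\<omega>. f n \<omega> \<partial>L) \<longlonglongrightarrow> measure L (C \<inter> Omega)"
      if L: "prob_space L" "sets L = sets PP" for L
    proof -
      interpret L: prob_space L by fact
      have meas: "h \<in> borel_measurable L" if "h \<in> borel_measurable borel" for h :: "_ \<Rightarrow> real"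
        using measurable_compose[OF id_PP that] L(2) by (simp cong: measurable_cong_sets)
      have "(\<lambda>n. \<integral>\<omega>. f n \<omega> \<partial>L) \<longlonglongrightarrow> (\<integral>\<omega>. indicator C \<omega> \<partial>L)"
      proof (rule integral_dominated_convergence[where w="\<lambda>_. 1"])
        show "(indicator C :: _ \<Rightarrow> real) \<in> borel_measurable L" using C by (intro meas) auto
        show "f n \<in> borel_measurable L" for n
          unfolding f_def by (intro meas borel_measurable_continuous_onI continuous_intros)
      qed (use f_lim f_bound in auto)
      then show ?thesis
        using space_eq_Omega[OF L(2)] by simp
    qed
    show ?thesis
      using LIMSEQ_unique[OF lim[OF M] lim[OF N, folded eq[OF f]]] .
  qed simp
  \<comment> \<open>Pushing both measures to the full function space lets closed sets act as the
    generator; every measurable subset of \<open>Omega\<close> is the trace of a Borel set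
    there.\<close>
  have distr_eq: "distr M borel (\<lambda>\<omega>. \<omega>) = distr N borel (\<lambda>\<omega>. \<omega>)"
  proof (rule measure_eqI_generator_eq[where E="Collect closed" and \<Omega>=UNIV and A="\<lambda>_. UNIV"])
    show "emeasure (distr M borel (\<lambda>\<omega>. \<omega>)) C = emeasure (distr N borel (\<lambda>\<omega>. \<omega>)) C"
      if "C \<in> Collect closed" for C
      using that closed_eq by (simp add: emeasure_distr space M.emeasure_eq_measure N.emeasure_eq_measure)
    show "emeasure (distr M borel (\<lambda>\<omega>. \<omega>)) UNIV \<noteq> \<infinity>"
      by (simp add: emeasure_distr)
  qed (auto simp: Int_stable_def borel_eq_closed)
  show ?thesis
  proof (rule measure_eqI)
    fix A assume "A \<in> sets M"
    then obtain B where B: "B \<in> sets borel" "A = B \<inter> Omega"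
      using M(2) by (auto simp: sets_PP sets_restrict_space)
    then show "emeasure M A = emeasure N A"
      using arg_cong[OF distr_eq, of "\<lambda>L. emeasure L B"] by (simp add: emeasure_distr space)
  qed (simp add: M N)
qed

section \<open>Prepending a spin, and eigenmeasures as fixed points\<close>

lemma case_nat_Omega: "u \<in> circle \<Longrightarrow> \<omega> \<in> Omega \<Longrightarrow> case_nat u \<omega> \<in> Omega"
  by (auto simp: Omega_def Pi_iff split: nat.split)

lemma measurable_prepend: "(\<lambda>(u, \<omega>). case_nat u \<omega>) \<in> haar_circle \<Otimes>\<^sub>M PP \<rightarrow>\<^sub>M PP"
  unfolding PP_def by measurable

text \<open>Both orders of integration are needed: freezing the new spin serves the recursion over
  coordinates, freezing the old configuration serves the transfer operator.\<close>

lemma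
  fixes f :: "(nat \<Rightarrow> real^2) \<Rightarrow> real"
  assumes L: "prob_space L" "sets L = sets haar_circle" and M: "prob_space M" "sets M = sets PP"
    and f: "f \<in> borel_measurable PP" "\<And>\<omega>. \<omega> \<in> Omega \<Longrightarrow> \<bar>f \<omega>\<bar> \<le> B"
  shows integral_prepend:
      "(\<integral>\<omega>. f \<omega> \<partial>distr (L \<Otimes>\<^sub>M M) PP (\<lambda>(u, \<omega>). case_nat u \<omega>)) = (\<integral>u. (\<integral>\<omega>. f (case_nat u \<omega>) \<partial>M) \<partial>L)"
    and integral_prepend_swap:
      "(\<integral>\<omega>. f \<omega> \<partial>distr (L \<Otimes>\<^sub>M M) PP (\<lambda>(u, \<omega>). case_nat u \<omega>)) = (\<integral>\<omega>. (\<integral>u. f (case_nat u \<omega>) \<partial>L) \<partial>M)"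
proof -
  interpret L: prob_space L by fact
  interpret M: prob_space M by fact
  interpret pair_prob_space L M ..
  have spaces: "space L = circle" "space M = Omega"
    using sets_eq_imp_space_eq[OF L(2)] space_eq_Omega[OF M(2)] by auto
  have m: "(\<lambda>(u, \<omega>). case_nat u \<omega>) \<in> L \<Otimes>\<^sub>M M \<rightarrow>\<^sub>M PP"
    using measurable_prepend L(2) M(2) by (simp cong: measurable_cong_sets sets_pair_measure_cong)
  have mf: "(\<lambda>(u, \<omega>). f (case_nat u \<omega>)) \<in> borel_measurable (L \<Otimes>\<^sub>M M)"
    using measurable_compose[OF m f(1)] by (simp add: case_prod_unfold)
  have int: "integrable (L \<Otimes>\<^sub>M M) (\<lambda>(u, \<omega>). f (case_nat u \<omega>))"
    by (intro integrable_const_bound[where B=B] AE_I2 mf)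
       (auto simp: space_pair_measure spaces intro!: f(2) case_nat_Omega)
  have "(\<integral>\<omega>. f \<omega> \<partial>distr (L \<Otimes>\<^sub>M M) PP (\<lambda>(u, \<omega>). case_nat u \<omega>))
      = (\<integral>z. (case z of (u, \<omega>) \<Rightarrow> f (case_nat u \<omega>)) \<partial>(L \<Otimes>\<^sub>M M))"
    by (subst integral_distr[OF m f(1)]) (simp add: case_prod_unfold)
  then show "(\<integral>\<omega>. f \<omega> \<partial>distr (L \<Otimes>\<^sub>M M) PP (\<lambda>(u, \<omega>). case_nat u \<omega>)) = (\<integral>u. (\<integral>\<omega>. f (case_nat u \<omega>) \<partial>M) \<partial>L)"
    "(\<integral>\<omega>. f \<omega> \<partial>distr (L \<Otimes>\<^sub>M M) PP (\<lambda>(u, \<omega>). case_nat u \<omega>)) = (\<integral>\<omega>. (\<integral>u. f (case_nat u \<omega>) \<partial>L) \<partial>M)"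
    using integral_fst'[OF int] integral_snd[OF int] by simp_all
qed

text \<open>Absorbing exp(t . u) / I_0 into the law of the spin exhibits the transfer operator as
  I_0 times a Markov operator.\<close>

lemma transfer_op_eq:
  fixes f :: "(nat \<Rightarrow> real^2) \<Rightarrow> real"
  assumes f: "f \<in> borel_measurable PP" and \<omega>: "\<omega> \<in> Omega"
  shows "transfer_op t f \<omega> = bessel_I0 (norm t) * (\<integral>u. f (case_nat u \<omega>) \<partial>field_measure t)"
proof -
  have "(\<lambda>u. (u, \<omega>)) \<in> haar_circle \<rightarrow>\<^sub>M haar_circle \<Otimes>\<^sub>M PP"
    using \<omega> by (intro measurable_Pair2') simp
  from measurable_compose[OF measurable_compose[OF this measurable_prepend] f]
  have m [measurable]: "(\<lambda>u. f (case_nat u \<omega>)) \<in> borel_measurable haar_circle"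
    by simp
  note [measurable] = measurable_inner_haar
  have "transfer_op t f \<omega> = circle_avg (\<lambda>u. exp (t \<bullet> u) * f (case_nat u \<omega>))"
    by (simp add: transfer_op_def circle_avg_def)
  also have "\<dots> = (\<integral>u. exp (t \<bullet> u) * f (case_nat u \<omega>) \<partial>haar_circle)"
    by (intro integral_haar_circle[symmetric]) measurable
  finally show ?thesis
    by (simp add: integral_field_measure[OF m])
qed

text \<open>Up to the positive factor I_0, the adjoint of the transfer operator sends
  \<open>\<mu>\<close> to the law of the configuration after prepending an independent tilted spin.
  Continuous functions determine measures, so the eigenmeasure equation becomes a fixed-point
  equation between measures.\<close>

lemma is_dyn_gibbs_iff:
  "is_dyn_gibbs t \<mu> \<longleftrightarrow> prob_space \<mu> \<and> sets \<mu> = sets PP \<and>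
     \<mu> = distr (field_measure t \<Otimes>\<^sub>M \<mu>) PP (\<lambda>(u, \<omega>). case_nat u \<omega>)"
proof (cases "prob_space \<mu> \<and> sets \<mu> = sets PP")
  case True
  then interpret prob_space \<mu> by simp
  interpret nu: prob_space "field_measure t" by (rule prob_space_field_measure)
  interpret P: pair_prob_space "field_measure t" \<mu> ..
  let ?D = "distr (field_measure t \<Otimes>\<^sub>M \<mu>) PP (\<lambda>(u, \<omega>). case_nat u \<omega>)"
  have m: "(\<lambda>(u, \<omega>). case_nat u \<omega>) \<in> field_measure t \<Otimes>\<^sub>M \<mu> \<rightarrow>\<^sub>M PP"
    using measurable_prepend True sets_field_measure
    by (simp cong: measurable_cong_sets sets_pair_measure_cong)
  have D: "prob_space ?D" by (intro P.prob_space_distr m)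
  have key: "(\<integral>\<omega>. transfer_op t f \<omega> \<partial>\<mu>) = bessel_I0 (norm t) * (\<integral>\<omega>. f \<omega> \<partial>?D)"
    if fc: "continuous_on Omega f" for f
  proof -
    note f = measurable_PP_of_continuous[OF fc]
    obtain B where B: "\<And>\<omega>. \<omega> \<in> Omega \<Longrightarrow> \<bar>f \<omega>\<bar> \<le> B"
      using bounded_of_continuous[OF fc] by blast
    have "(\<integral>\<omega>. transfer_op t f \<omega> \<partial>\<mu>)
        = (\<integral>\<omega>. bessel_I0 (norm t) * (\<integral>u. f (case_nat u \<omega>) \<partial>field_measure t) \<partial>\<mu>)"
      using True by (intro Bochner_Integration.integral_cong) (auto simp: space_eq_Omega transfer_op_eq[OF f])
    then show ?thesis
      using True integral_prepend_swap[OF prob_space_field_measure sets_field_measure _ _ f B, of \<mu> t]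
      by simp
  qed
  show ?thesis
  proof
    assume L: "is_dyn_gibbs t \<mu>"
    have "\<mu> = ?D"
    proof (rule measure_eqI_continuous)
      fix f :: "(nat \<Rightarrow> real^2) \<Rightarrow> real" assume f: "continuous_on Omega f"
      then have "bessel_I0 (norm t) * (\<integral>\<omega>. f \<omega> \<partial>?D) = bessel_I0 (norm t) * (\<integral>\<omega>. f \<omega> \<partial>\<mu>)"
        using key[OF f] L unfolding is_dyn_gibbs_def by metis
      then show "(\<integral>\<omega>. f \<omega> \<partial>\<mu>) = (\<integral>\<omega>. f \<omega> \<partial>?D)"
        using bessel_I0_pos[of "norm t"] by simp
    qed (use True D in auto)
    with True show "prob_space \<mu> \<and> sets \<mu> = sets PP \<and> \<mu> = ?D" by blast
  next
    assume "prob_space \<mu> \<and> sets \<mu> = sets PP \<and> \<mu> = ?D"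
    then show "is_dyn_gibbs t \<mu>"
      using key by (simp add: is_dyn_gibbs_def)
  qed
qed (auto simp: is_dyn_gibbs_def)

lemma field_product_prepend:
  "distr (field_measure t \<Otimes>\<^sub>M field_product t) PP (\<lambda>(u, \<omega>). case_nat u \<omega>) = field_product t"
proof -
  interpret sequence_space "field_measure t" by (rule sequence_space_field_measure)
  have "distr (field_measure t \<Otimes>\<^sub>M field_product t) PP (\<lambda>(u, \<omega>). case_nat u \<omega>)
      = distr (field_measure t \<Otimes>\<^sub>M field_product t) (field_product t) (\<lambda>(u, \<omega>). case_nat u \<omega>)"
    by (intro distr_cong) (simp_all add: sets_field_product)
  then show ?thesis
    using PiM_iter by (simp add: field_product_def)
qed

lemma PP_prepend: "distr (haar_circle \<Otimes>\<^sub>M PP) PP (\<lambda>(u, \<omega>). case_nat u \<omega>) = PP"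
proof -
  interpret sequence_space haar_circle by (rule sequence_space_haar_circle)
  show ?thesis using PiM_iter by (simp add: PP_def)
qed

lemma sets_cylinder:
  assumes "\<And>k. A k \<in> sets haar_circle"
  shows "{\<omega> \<in> Omega. \<forall>k<n. \<omega> k \<in> A k} \<in> sets PP"
proof -
  note [measurable] = measurable_coordinate assms
  have "{\<omega> \<in> space PP. \<forall>k<n. \<omega> k \<in> A k} \<in> sets PP" by measurable
  then show ?thesis by (simp only: space_PP)
qed

text \<open>Each use of the fixed-point equation splits off coordinate 0 as an independent factor
  and leaves a cylinder with shifted sides; hence the induction is over arbitrary
  \<open>A\<close>.\<close>

lemma emeasure_cylinder_of_prepend:
  assumes \<mu>: "prob_space \<mu>" "sets \<mu> = sets PP"
    and fixpt: "\<mu> = distr (field_measure t \<Otimes>\<^sub>M \<mu>) PP (\<lambda>(u, \<omega>). case_nat u \<omega>)"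
    and A: "\<And>k. A k \<in> sets haar_circle"
  shows "emeasure \<mu> {\<omega> \<in> Omega. \<forall>k<n. \<omega> k \<in> A k} = (\<Prod>k<n. emeasure (field_measure t) (A k))"
  using A
proof (induction n arbitrary: A)
  case 0
  then show ?case
    using prob_space.emeasure_space_1[OF \<mu>(1)] space_eq_Omega[OF \<mu>(2)] by simp
next
  case (Suc n)
  interpret prob_space \<mu> by fact
  have spaces: "space \<mu> = Omega" using space_eq_Omega[OF \<mu>(2)] .
  have m: "(\<lambda>(u, \<omega>). case_nat u \<omega>) \<in> field_measure t \<Otimes>\<^sub>M \<mu> \<rightarrow>\<^sub>M PP"
    using measurable_prepend \<mu>(2) sets_field_measure
    by (simp cong: measurable_cong_sets sets_pair_measure_cong)
  have A0: "A 0 \<subseteq> circle" using sets.sets_into_space[OF Suc.prems, of 0] by simp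
  have "emeasure \<mu> {\<omega> \<in> Omega. \<forall>k<Suc n. \<omega> k \<in> A k}
      = emeasure (field_measure t \<Otimes>\<^sub>M \<mu>)
          ((\<lambda>(u, \<omega>). case_nat u \<omega>) -` {\<omega> \<in> Omega. \<forall>k<Suc n. \<omega> k \<in> A k} \<inter> space (field_measure t \<Otimes>\<^sub>M \<mu>))"
    by (subst fixpt) (intro emeasure_distr m sets_cylinder Suc.prems)
  also have "(\<lambda>(u, \<omega>). case_nat u \<omega>) -` {\<omega> \<in> Omega. \<forall>k<Suc n. \<omega> k \<in> A k} \<inter> space (field_measure t \<Otimes>\<^sub>M \<mu>)
      = A 0 \<times> {\<omega> \<in> Omega. \<forall>k<n. \<omega> k \<in> A (Suc k)}"
    using A0 by (auto simp: space_pair_measure spaces All_less_Suc2 intro!: case_nat_Omega)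
  also have "emeasure (field_measure t \<Otimes>\<^sub>M \<mu>) \<dots>
      = emeasure (field_measure t) (A 0) * emeasure \<mu> {\<omega> \<in> Omega. \<forall>k<n. \<omega> k \<in> A (Suc k)}"
  proof (rule emeasure_pair_measure_Times)
    show "A 0 \<in> sets (field_measure t)" by (simp add: sets_field_measure Suc.prems)
    show "{\<omega> \<in> Omega. \<forall>k<n. \<omega> k \<in> A (Suc k)} \<in> sets \<mu>"
      unfolding \<mu>(2) by (intro sets_cylinder Suc.prems)
  qed
  also have "emeasure \<mu> {\<omega> \<in> Omega. \<forall>k<n. \<omega> k \<in> A (Suc k)} = (\<Prod>k<n. emeasure (field_measure t) (A (Suc k)))"
    by (intro Suc.IH Suc.prems)
  finally show ?case
    by (simp add: prod.lessThan_Suc_shift del: prod.lessThan_Suc)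
qed

lemma is_dyn_gibbs_unique:
  assumes "is_dyn_gibbs t \<mu>"
  shows "\<mu> = field_product t"
proof -
  from assms have \<mu>: "prob_space \<mu>" "sets \<mu> = sets PP"
    and fixpt: "\<mu> = distr (field_measure t \<Otimes>\<^sub>M \<mu>) PP (\<lambda>(u, \<omega>). case_nat u \<omega>)"
    using is_dyn_gibbs_iff by blast+
  interpret sequence_space "field_measure t" by (rule sequence_space_field_measure)
  show ?thesis
    unfolding field_product_def
  proof (rule PiM_eq)
    show "sets \<mu> = sets S"
      using \<mu>(2) sets_field_product by (simp add: field_product_def)
    fix J :: "nat set" and E
    assume J: "finite J" and E: "\<And>j. j \<in> J \<Longrightarrow> E j \<in> sets (field_measure t)"
    \<comment> \<open>A cylinder over an arbitrary finite index set becomes one over an initial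
      segment by inserting the full circle, of mass 1, at the missing indices.\<close>
    define A where "A k = (if k \<in> J then E k else circle)" for k
    obtain n where n: "J \<subseteq> {..<n}"
      using finite_nat_bounded[OF J] by blast
    then have less: "j < n" if "j \<in> J" for j using that by auto
    have A: "A k \<in> sets haar_circle" for k
      using E sets.top[of haar_circle] by (auto simp: A_def sets_field_measure)
    have "E j \<subseteq> circle" if "j \<in> J" for j
      using sets.sets_into_space[OF E[OF that]] by simp
    then have "prod_emb UNIV (\<lambda>_. field_measure t) J (Pi\<^sub>E J E) = {\<omega> \<in> Omega. \<forall>k<n. \<omega> k \<in> A k}"
      using less by (auto simp: prod_emb_def A_def Omega_eq_PiE PiE_iff)
    moreover have "(\<Prod>k<n. emeasure (field_measure t) (A k)) = (\<Prod>j\<in>J. emeasure (field_measure t) (A j))"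
      using n M.emeasure_space_1 by (intro prod.mono_neutral_right) (auto simp: A_def)
    moreover have "\<dots> = (\<Prod>j\<in>J. emeasure (field_measure t) (E j))"
      by (intro prod.cong) (auto simp: A_def)
    ultimately show "emeasure \<mu> (prod_emb UNIV (\<lambda>_. field_measure t) J (Pi\<^sub>E J E))
        = (\<Prod>j\<in>J. emeasure (field_measure t) (E j))"
      using emeasure_cylinder_of_prepend[OF \<mu> fixpt A, of n] by simp
  qed
qed

lemma dyn_gibbs_eq: "dyn_gibbs t = field_product t"
  unfolding dyn_gibbs_def
proof (rule the_equality)
  show "is_dyn_gibbs t (field_product t)"
    unfolding is_dyn_gibbs_iff
    using prob_space_field_product sets_field_product field_product_prepend by metis
qed (rule is_dyn_gibbs_unique)

text \<open>For \<open>t \<noteq> 0\<close> the product measure and \<open>PP\<close> are mutually singular, but on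
  functions of finitely many coordinates the former has the expected density.\<close>

lemma integral_cylinder:
  fixes h :: "(nat \<Rightarrow> real^2) \<Rightarrow> real"
  assumes "h \<in> borel_measurable PP" "\<And>\<omega>. \<omega> \<in> Omega \<Longrightarrow> \<bar>h \<omega>\<bar> \<le> B"
    and "\<And>\<omega> \<omega>'. \<omega> \<in> Omega \<Longrightarrow> \<omega>' \<in> Omega \<Longrightarrow> (\<And>k. k < n \<Longrightarrow> \<omega> k = \<omega>' k) \<Longrightarrow> h \<omega> = h \<omega>'"
  shows "(\<integral>\<omega>. h \<omega> * exp (t \<bullet> (\<Sum>k<n. \<omega> k)) \<partial>PP) = bessel_I0 (norm t) ^ n * (\<integral>\<omega>. h \<omega> \<partial>field_product t)"
  using assms
proof (induction n arbitrary: h)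
  case 0
  define w :: "nat \<Rightarrow> real^2" where "w = (\<lambda>_. uvec 0)"
  have "w \<in> Omega" by (simp add: w_def Omega_def)
  then have h: "h \<omega> = h w" if "\<omega> \<in> Omega" for \<omega> using 0(3)[OF that] by simp
  have "(\<integral>\<omega>. h \<omega> \<partial>M) = h w" if "prob_space M" "sets M = sets PP" for M
  proof -
    have "(\<integral>\<omega>. h \<omega> \<partial>M) = (\<integral>\<omega>. h w \<partial>M)"
      using h space_eq_Omega[OF that(2)] by (intro Bochner_Integration.integral_cong) auto
    then show ?thesis using prob_space.prob_space[OF that(1)] by simp
  qed
  then show ?case
    using prob_space_PP prob_space_field_product sets_field_product by simp
next
  case (Suc n)
  define f where "f \<omega> = h \<omega> * exp (t \<bullet> (\<Sum>k<Suc n. \<omega> k))" for \<omega>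
  have [measurable]: "h \<in> borel_measurable PP" by fact
  have f: "f \<in> borel_measurable PP" unfolding f_def by measurable
  have "B \<ge> 0" using Suc.prems(2)[of "\<lambda>_. uvec 0"] by (auto simp: Omega_def intro: order_trans[OF abs_ge_zero])
  have f_bound: "\<bar>f \<omega>\<bar> \<le> B * exp (norm t * real (Suc n))" if "\<omega> \<in> Omega" for \<omega>
  proof -
    have "t \<bullet> (\<Sum>k<Suc n. \<omega> k) \<le> (\<Sum>k<Suc n. norm t)"
      unfolding inner_sum_right using abs_inner_circle_le[of _ t] that
      by (intro sum_mono) (force simp: Omega_def abs_le_iff)
    then show ?thesis
      unfolding f_def abs_mult using Suc.prems(2)[OF that] \<open>B \<ge> 0\<close>
      by (intro mult_mono) (auto simp: mult.commute)
  qed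
  let ?I = "bessel_I0 (norm t)"
  have prep [measurable]: "(\<lambda>\<omega>. case_nat u \<omega>) \<in> PP \<rightarrow>\<^sub>M PP" if "u \<in> circle" for u
  proof -
    have "(\<lambda>\<omega>. (u, \<omega>)) \<in> PP \<rightarrow>\<^sub>M haar_circle \<Otimes>\<^sub>M PP"
      using that by (intro measurable_Pair1') simp
    from measurable_compose[OF this measurable_prepend] show ?thesis by simp
  qed
  \<comment> \<open>With the spin 0 frozen at \<open>u\<close>, the rest depends on n coordinates
    and falls under the induction hypothesis; the remaining tilt exp(t . u) then supplies the last
    factor I_0.\<close>
  have "(\<integral>\<omega>. f \<omega> \<partial>PP) = (\<integral>u. (\<integral>\<omega>. f (case_nat u \<omega>) \<partial>PP) \<partial>haar_circle)"
    using integral_prepend[OF prob_space_haar_circle refl prob_space_PP refl f f_bound]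
    by (simp add: PP_prepend)
  also have "\<dots> = (\<integral>u. exp (t \<bullet> u) * (?I ^ n * (\<integral>\<omega>. h (case_nat u \<omega>) \<partial>field_product t)) \<partial>haar_circle)"
  proof (intro Bochner_Integration.integral_cong refl)
    fix u assume "u \<in> space haar_circle"
    then have u: "u \<in> circle" by simp
    have "(\<integral>\<omega>. f (case_nat u \<omega>) \<partial>PP)
        = (\<integral>\<omega>. exp (t \<bullet> u) * (h (case_nat u \<omega>) * exp (t \<bullet> (\<Sum>k<n. \<omega> k))) \<partial>PP)"
      by (simp add: f_def sum.lessThan_Suc_shift inner_add_right exp_add mult_ac del: sum.lessThan_Suc)
    also have "\<dots> = exp (t \<bullet> u) * (\<integral>\<omega>. h (case_nat u \<omega>) * exp (t \<bullet> (\<Sum>k<n. \<omega> k)) \<partial>PP)"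
      by simp
    also have "(\<integral>\<omega>. h (case_nat u \<omega>) * exp (t \<bullet> (\<Sum>k<n. \<omega> k)) \<partial>PP)
        = ?I ^ n * (\<integral>\<omega>. h (case_nat u \<omega>) \<partial>field_product t)"
    proof (rule Suc.IH)
      show "(\<lambda>\<omega>. h (case_nat u \<omega>)) \<in> borel_measurable PP"
        using measurable_compose[OF prep[OF u] Suc.prems(1)] .
      show "\<bar>h (case_nat u \<omega>)\<bar> \<le> B" if "\<omega> \<in> Omega" for \<omega>
        using Suc.prems(2) case_nat_Omega[OF u that] .
      show "h (case_nat u \<omega>) = h (case_nat u \<omega>')"
        if "\<omega> \<in> Omega" "\<omega>' \<in> Omega" "\<And>k. k < n \<Longrightarrow> \<omega> k = \<omega>' k" for \<omega> \<omega>'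
        using that u by (intro Suc.prems(3) case_nat_Omega) (auto split: nat.split)
    qed
    finally show "(\<integral>\<omega>. f (case_nat u \<omega>) \<partial>PP)
        = exp (t \<bullet> u) * (?I ^ n * (\<integral>\<omega>. h (case_nat u \<omega>) \<partial>field_product t))" .
  qed
  also have "\<dots> = ?I * (\<integral>u. ?I ^ n * (\<integral>\<omega>. h (case_nat u \<omega>) \<partial>field_product t) \<partial>field_measure t)"
  proof (rule integral_field_measure[symmetric])
    interpret prob_space "field_product t" by (rule prob_space_field_product)
    have "(\<lambda>(u, \<omega>). h (case_nat u \<omega>)) \<in> borel_measurable (haar_circle \<Otimes>\<^sub>M PP)"
      using measurable_compose[OF measurable_prepend Suc.prems(1)] by (simp add: case_prod_unfold)
    then have "(\<lambda>(u, \<omega>). h (case_nat u \<omega>)) \<in> borel_measurable (haar_circle \<Otimes>\<^sub>M field_product t)"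
      by (simp cong: measurable_cong_sets sets_pair_measure_cong add: sets_field_product)
    then show "(\<lambda>u. ?I ^ n * (\<integral>\<omega>. h (case_nat u \<omega>) \<partial>field_product t)) \<in> borel_measurable haar_circle"
      by (intro borel_measurable_times borel_measurable_const borel_measurable_lebesgue_integral)
  qed
  also have "\<dots> = ?I ^ Suc n * (\<integral>\<omega>. h \<omega> \<partial>field_product t)"
    using integral_prepend[OF prob_space_field_measure sets_field_measure prob_space_field_product
        sets_field_product Suc.prems(1,2), of t t] field_product_prepend[of t]
    by simp
  finally show ?case by (simp add: f_def)
qed

section \<open>Measurable dependence on the external field\<close>

lemma continuous_on_bessel_I0: "continuous_on S bessel_I0"
proof -
  have "continuous_on S (bessel_moment 0)"
    by (intro continuous_at_imp_continuous_on ballI DERIV_isCont[OF DERIV_bessel_moment])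
  then have "continuous_on S (\<lambda>y. bessel_moment 0 y / pi)"
    by (intro continuous_intros) auto
  then show ?thesis by (simp add: bessel_I0_eq_moment [abs_def])
qed

lemma borel_measurable_bessel_I0 [measurable]: "bessel_I0 \<in> borel_measurable borel"
  by (intro borel_measurable_continuous_onI continuous_on_bessel_I0)

text \<open>Finite-dimensional cylinders suffice, being an intersection-stable generator; on each of
  them the mass is a finite product of integrals that depend measurably on the field.\<close>

lemma measurable_field_product [measurable]: "field_product \<in> borel \<rightarrow>\<^sub>M prob_algebra PP"
proof (rule measurable_prob_algebra_generated)
  show "sets PP = sigma_sets (\<Pi>\<^sub>E i\<in>UNIV. space haar_circle) (prod_algebra UNIV (\<lambda>_. haar_circle))"
    by (simp add: PP_def sets_PiM)
  show "Int_stable (prod_algebra UNIV (\<lambda>_::nat. haar_circle))"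
    by (rule Int_stable_prod_algebra)
  show "prod_algebra UNIV (\<lambda>_::nat. haar_circle) \<subseteq> Pow (\<Pi>\<^sub>E i\<in>UNIV. space haar_circle)"
    by (rule prod_algebra_sets_into_space)
  fix X assume "X \<in> prod_algebra UNIV (\<lambda>_::nat. haar_circle)"
  then obtain J E where X: "X = prod_emb UNIV (\<lambda>_. haar_circle) J (\<Pi>\<^sub>E j\<in>J. E j)"
    and J: "finite J" and E: "\<And>i. i \<in> J \<Longrightarrow> E i \<in> sets haar_circle"
    by (rule prod_algebraE) blast
  have "emeasure (field_product t) X = (\<Prod>i\<in>J. emeasure (field_measure t) (E i))" for t
  proof -
    interpret sequence_space "field_measure t" by (rule sequence_space_field_measure)
    have "X = prod_emb UNIV (\<lambda>_. field_measure t) J (\<Pi>\<^sub>E j\<in>J. E j)"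
      by (simp add: X prod_emb_def)
    then show ?thesis
      unfolding field_product_def using J E by (simp add: emeasure_PiM_emb sets_field_measure)
  qed
  moreover have "(\<lambda>t. emeasure (field_measure t) A) \<in> borel_measurable borel"
    if A [measurable]: "A \<in> sets haar_circle" for A
  proof -
    interpret prob_space haar_circle by (rule prob_space_haar_circle)
    note [measurable] = measurable_inner_haar measurable_haar_borel
    have "emeasure (field_measure t) A
        = (\<integral>\<^sup>+u. ennreal (exp (t \<bullet> u) / bessel_I0 (norm t)) * indicator A u \<partial>haar_circle)" for t
      unfolding field_measure_def by (intro emeasure_density) measurable
    moreover have "(\<lambda>t. \<integral>\<^sup>+u. ennreal (exp (t \<bullet> u) / bessel_I0 (norm t)) * indicator A u \<partial>haar_circle)
        \<in> borel_measurable borel"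
      by measurable
    ultimately show ?thesis by simp
  qed
  ultimately show "(\<lambda>t. emeasure (field_product t) X) \<in> borel_measurable borel"
    using E by simp
qed (auto simp: prob_space_field_product sets_field_product)

subsection \<open>The mixtures \<open>\<eta>\<^sub>x\<close>\<close>

text \<open>The mixture is the monadic bind of the uniform angle with the kernel of product
  measures.\<close>

lemma is_eta_exists: "\<exists>\<nu>. is_eta x \<nu>"
proof -
  define U where "U = uniform_measure lborel {-pi..pi}"
  define K where "K = (\<lambda>\<theta>. field_product (x *\<^sub>R uvec \<theta>))"
  have U: "prob_space U" "sets U = sets borel"
    by (simp_all add: U_def prob_space_uniform_angle)
  have "K \<in> borel \<rightarrow>\<^sub>M prob_algebra PP"
    unfolding K_def by measurable
  then have K: "K \<in> U \<rightarrow>\<^sub>M prob_algebra PP"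
    using U(2) by (simp cong: measurable_cong_sets)
  have UA: "U \<in> space (prob_algebra U)"
    using U(1) by (simp add: space_prob_algebra)
  have "is_eta x (U \<bind> K)"
    unfolding is_eta_def
  proof (intro conjI ballI impI)
    show "prob_space (U \<bind> K)" using UA K by (rule prob_space_bind')
    show "sets (U \<bind> K) = sets PP" using UA K by (rule sets_bind')
    fix h :: "(nat \<Rightarrow> real^2) \<Rightarrow> real"
    assume h: "h \<in> borel_measurable PP" and "\<exists>B. \<forall>\<omega>\<in>Omega. \<bar>h \<omega>\<bar> \<le> B"
    then obtain B where B: "\<And>\<omega>. \<omega> \<in> Omega \<Longrightarrow> \<bar>h \<omega>\<bar> \<le> B" by blast
    have "(\<integral>\<omega>. h \<omega> \<partial>(U \<bind> K)) = (\<integral>\<theta>. (\<integral>\<omega>. h \<omega> \<partial>K \<theta>) \<partial>U)"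
    proof (rule integral_bind[OF h _ measurable_prob_algebraD[OF K], of B 1])
      show "finite_measure U" using U(1) by (rule prob_space.finite_measure)
      show "AE \<theta> in U. emeasure (K \<theta>) (space (K \<theta>)) \<le> ennreal 1"
        unfolding K_def using prob_space.emeasure_space_1[OF prob_space_field_product] by simp
    qed (use B in simp)
    also have "\<dots> = 1 / (2 * pi) * (LBINT \<theta>:{-pi..pi}. (\<integral>\<omega>. h \<omega> \<partial>K \<theta>))"
      unfolding U_def
    proof (rule integral_uniform_angle)
      have "(\<lambda>M. \<integral>\<omega>. h \<omega> \<partial>M) \<in> borel_measurable (subprob_algebra PP)"
        using h B by (intro integral_measurable_subprob_algebra) auto
      then show "(\<lambda>\<theta>. \<integral>\<omega>. h \<omega> \<partial>K \<theta>) \<in> borel_measurable borel"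
        by (rule measurable_compose[OF measurable_prob_algebraD[OF \<open>K \<in> borel \<rightarrow>\<^sub>M prob_algebra PP\<close>]])
    qed
    finally show "(\<integral>\<omega>. h \<omega> \<partial>(U \<bind> K))
        = 1 / (2 * pi) * (LBINT \<theta>:{-pi..pi}. (\<integral>\<omega>. h \<omega> \<partial>dyn_gibbs (x *\<^sub>R uvec \<theta>)))"
      by (simp add: K_def dyn_gibbs_eq)
  qed
  then show ?thesis ..
qed

text \<open>Indicators are bounded and measurable, so the defining identity prescribes the mass of
  every set.\<close>

lemma is_eta_unique:
  assumes "is_eta x \<mu>" "is_eta x \<nu>"
  shows "\<mu> = \<nu>"
proof (rule measure_eqI)
  show "sets \<mu> = sets \<nu>" using assms by (simp add: is_eta_def)
  fix A assume A: "A \<in> sets \<mu>"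
  have ind: "(indicator A :: _ \<Rightarrow> real) \<in> borel_measurable PP"
    "\<exists>B. \<forall>\<omega>\<in>Omega. \<bar>indicator A \<omega> :: real\<bar> \<le> B"
    using A assms by (auto simp: is_eta_def indicator_def intro!: borel_measurable_indicator exI[of _ 1])
  have "(\<integral>\<omega>. indicator A \<omega> \<partial>L) = 1 / (2 * pi) *
      (LBINT \<theta>:{-pi..pi}. (\<integral>\<omega>. indicator A \<omega> \<partial>(dyn_gibbs (x *\<^sub>R uvec \<theta>))))" if "is_eta x L" for L
    using that ind unfolding is_eta_def by blast
  then have "(\<integral>\<omega>. indicator A \<omega> \<partial>\<mu>) = (\<integral>\<omega>. indicator A \<omega> \<partial>\<nu> :: real)"
    using assms by simp
  moreover have "A \<subseteq> Omega" "space \<mu> = Omega" "space \<nu> = Omega"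
    using A assms sets.sets_into_space by (fastforce simp: is_eta_def space_eq_Omega)+
  ultimately have "measure \<mu> A = measure \<nu> A"
    by (simp add: Int_absorb2)
  then show "emeasure \<mu> A = emeasure \<nu> A"
    using assms by (simp add: is_eta_def prob_space.finite_measure finite_measure.emeasure_eq_measure)
qed

lemma is_eta_eta: "is_eta x (eta x)"
  unfolding eta_def using is_eta_exists is_eta_unique by (metis theI)

lemma integral_eta:
  assumes "continuous_on Omega h"
  shows "(\<integral>\<omega>. h \<omega> \<partial>eta x) = circle_avg (\<lambda>u. \<integral>\<omega>. h \<omega> \<partial>field_product (x *\<^sub>R u))"
proof -
  have "\<exists>B. \<forall>\<omega>\<in>Omega. \<bar>h \<omega>\<bar> \<le> B"
    using assms by (rule bounded_of_continuous)
  then have "(\<integral>\<omega>. h \<omega> \<partial>eta x) = 1 / (2 * pi) *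
      (LBINT \<theta>:{-pi..pi}. (\<integral>\<omega>. h \<omega> \<partial>(dyn_gibbs (x *\<^sub>R uvec \<theta>))))"
    using is_eta_eta[of x] measurable_PP_of_continuous[OF assms] unfolding is_eta_def by blast
  then show ?thesis
    by (simp add: dyn_gibbs_eq circle_avg_def)
qed

subsection \<open>The mean-field Gibbs measures\<close>

text \<open>Only configurations in \<open>Omega\<close> are compared, since test functions are
  unconstrained outside it.\<close>

definition cylindrical :: "nat \<Rightarrow> ((nat \<Rightarrow> real^2) \<Rightarrow> real) \<Rightarrow> bool" where
  "cylindrical n h \<longleftrightarrow>
     (\<forall>\<omega>\<in>Omega. \<forall>\<omega>'\<in>Omega. (\<forall>k<n. \<omega> k = \<omega>' k) \<longrightarrow> h \<omega> = h \<omega>')"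

lemma cylindrical_mono: "cylindrical m h \<Longrightarrow> m \<le> n \<Longrightarrow> cylindrical n h"
  unfolding cylindrical_def by (blast intro: less_le_trans)

lemma norm_sum_Omega_le:
  assumes "\<omega> \<in> Omega"
  shows "norm (\<Sum>k<n. \<omega> k) \<le> real n"
proof -
  have "norm (\<omega> k) = 1" for k using assms by (auto simp: Omega_def circle_def)
  then show ?thesis
    using norm_sum[of \<omega> "{..<n}"] by simp
qed

lemma inner_sum_Omega_le:
  assumes "\<omega> \<in> Omega"
  shows "x \<bullet> (\<Sum>k<n. \<omega> k) \<le> norm x * real n"
  by (rule order_trans[OF norm_cauchy_schwarz mult_left_mono[OF norm_sum_Omega_le[OF assms] norm_ge_zero]])

lemma integral_field_product_cylindrical:
  assumes "h \<in> borel_measurable PP" "\<And>\<omega>. \<omega> \<in> Omega \<Longrightarrow> \<bar>h \<omega>\<bar> \<le> B" "cylindrical n h"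
  shows "(\<integral>\<omega>. h \<omega> * exp (t \<bullet> (\<Sum>k<n. \<omega> k)) \<partial>PP)
    = bessel_I0 (norm t) ^ n * (\<integral>\<omega>. h \<omega> \<partial>field_product t)"
proof (rule integral_cylinder[OF assms(1,2)])
  show "h \<omega> = h \<omega>'" if "\<omega> \<in> Omega" "\<omega>' \<in> Omega" "\<And>k. k < n \<Longrightarrow> \<omega> k = \<omega>' k" for \<omega> \<omega>'
    using assms(3) that unfolding cylindrical_def by blast
qed

text \<open>Rewritten against the fixed measure \<open>PP\<close>, the field sits only in an
  exponential and in a power of I_0. Along a convergent sequence the fields are bounded by some
  \<open>T\<close>, which gives a constant dominating function.\<close>

lemma continuous_on_integral_field_product:
  assumes h [measurable]: "h \<in> borel_measurable PP" and B: "\<And>\<omega>. \<omega> \<in> Omega \<Longrightarrow> \<bar>h \<omega>\<bar> \<le> B"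
    and cyl: "cylindrical n h"
  shows "continuous_on UNIV (\<lambda>t. \<integral>\<omega>. h \<omega> \<partial>field_product t)"
proof -
  interpret prob_space PP by (rule prob_space_PP)
  let ?N = "\<lambda>t. \<integral>\<omega>. h \<omega> * exp (t \<bullet> (\<Sum>k<n. \<omega> k)) \<partial>PP"
  have "isCont ?N t" for t
    unfolding continuous_at_sequentially comp_def
  proof safe
    fix s :: "nat \<Rightarrow> real^2" assume s: "s \<longlonglongrightarrow> t"
    then obtain T where T: "\<And>j. norm (s j) \<le> T"
      using convergent_imp_Bseq[of s] by (auto simp: convergent_def Bseq_def)
    show "(\<lambda>j. ?N (s j)) \<longlonglongrightarrow> ?N t"
    proof (rule integral_dominated_convergence[where w="\<lambda>_. B * exp (T * real n)"])
      show "AE \<omega> in PP. (\<lambda>j. h \<omega> * exp (s j \<bullet> (\<Sum>k<n. \<omega> k))) \<longlonglongrightarrow> h \<omega> * exp (t \<bullet> (\<Sum>k<n. \<omega> k))"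
        by (intro AE_I2 tendsto_intros s)
      show "AE \<omega> in PP. norm (h \<omega> * exp (s j \<bullet> (\<Sum>k<n. \<omega> k))) \<le> B * exp (T * real n)" for j
      proof (rule AE_I2)
        fix \<omega> assume "\<omega> \<in> space PP"
        then have \<omega>: "\<omega> \<in> Omega" by simp
        have "s j \<bullet> (\<Sum>k<n. \<omega> k) \<le> T * real n"
          using inner_sum_Omega_le[OF \<omega>, of "s j" n] mult_right_mono[OF T[of j], of "real n"] by simp
        then show "norm (h \<omega> * exp (s j \<bullet> (\<Sum>k<n. \<omega> k))) \<le> B * exp (T * real n)"
          unfolding norm_mult using B[OF \<omega>] by (intro mult_mono) auto
      qed
    qed auto
  qed
  then have "continuous_on UNIV (\<lambda>t. ?N t / bessel_I0 (norm t) ^ n)"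
    using bessel_I0_pos
    by (intro continuous_intros continuous_at_imp_continuous_on ballI
        continuous_on_compose2[OF continuous_on_bessel_I0[of UNIV]]) (auto simp: less_imp_neq[symmetric])
  moreover have "?N t / bessel_I0 (norm t) ^ n = (\<integral>\<omega>. h \<omega> \<partial>field_product t)" for t
    using bessel_I0_pos[of "norm t"] by (simp add: integral_field_product_cylindrical[OF h B cyl])
  ultimately show ?thesis by simp
qed

lemma abs_integral_le:
  fixes h :: "(nat \<Rightarrow> real^2) \<Rightarrow> real"
  assumes h: "h \<in> borel_measurable PP" and B: "\<And>\<omega>. \<omega> \<in> Omega \<Longrightarrow> \<bar>h \<omega>\<bar> \<le> B"
    and M: "prob_space M" "sets M = sets PP"
  shows "\<bar>\<integral>\<omega>. h \<omega> \<partial>M\<bar> \<le> B"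
proof -
  interpret prob_space M by fact
  have "\<bar>\<integral>\<omega>. h \<omega> \<partial>M\<bar> \<le> (\<integral>\<omega>. \<bar>h \<omega>\<bar> \<partial>M)"
    using integral_norm_bound[of M h] by simp
  also have "\<dots> \<le> (\<integral>\<omega>. B \<partial>M)"
    using integrable_bounded_PP[OF M h B] B space_eq_Omega[OF M(2)] by (intro integral_mono) auto
  also have "\<dots> = B" by (simp add: prob_space)
  finally show ?thesis .
qed

text \<open>This is where \<open>phi\<close> originates: a Gaussian weight times the n one-spin
  normalisers.\<close>

lemma exp_phi:
  assumes "\<beta> > 0"
  shows "exp (real n * phi \<beta> (norm x))
    = exp (- (real n * \<beta> / 2 * (norm x)\<^sup>2)) * bessel_I0 (norm (\<beta> *\<^sub>R x)) ^ n"
proof -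
  have "exp (real n * phi \<beta> (norm x))
      = exp (- (real n * \<beta> / 2 * (norm x)\<^sup>2)) * exp (real n * ln (bessel_I0 (norm (\<beta> *\<^sub>R x))))"
    using assms unfolding phi_def exp_add[symmetric] by (simp add: algebra_simps)
  then show ?thesis
    using bessel_I0_pos by (simp add: exp_of_nat_mult)
qed

lemma integrable_exp_phi:
  assumes "\<beta> > 0"
  shows "integrable lborel (\<lambda>x::'a::euclidean_space. exp (phi \<beta> (norm x)))"
proof (rule Bochner_Integration.integrable_bound)
  show "integrable lborel (\<lambda>x::'a. exp (- (\<beta> / 2 * (norm x)\<^sup>2) + \<beta> * norm x))"
    using assms by (intro integrable_gaussian_linear) simp
  have "continuous_on UNIV (\<lambda>x::'a. exp (phi \<beta> (norm x)))"
    by (intro continuous_intros continuous_on_compose2[OF continuous_on_phi[of UNIV]]) auto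
  then show "(\<lambda>x::'a. exp (phi \<beta> (norm x))) \<in> borel_measurable lborel"
    by (simp add: borel_measurable_continuous_onI)
  show "AE x in lborel. norm (exp (phi \<beta> (norm x)))
      \<le> norm (exp (- (\<beta> / 2 * (norm (x::'a))\<^sup>2) + \<beta> * norm x))"
    using phi_le[OF assms norm_ge_zero] by (intro AE_I2) simp
qed

text \<open>Hubbard-Stratonovich linearises the square of the total spin. After exchanging the
  integrals, the inner one over the spins factorises at fixed \<open>x\<close> into normalisers and
  an expectation under the product measure.\<close>

lemma gibbs_weight_integral:
  assumes \<beta>: "\<beta> > 0" and n: "n > 0"
    and h [measurable]: "h \<in> borel_measurable PP" and B: "\<And>\<omega>. \<omega> \<in> Omega \<Longrightarrow> \<bar>h \<omega>\<bar> \<le> B"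
    and cyl: "cylindrical n h"
  shows "(\<integral>\<omega>. h \<omega> * gibbs_weight n \<beta> \<omega> \<partial>PP) * (\<integral>x. exp (- (real n * \<beta> / 2 * (norm (x::real^2))\<^sup>2)) \<partial>lborel)
    = (\<integral>x. exp (real n * phi \<beta> (norm x)) * (\<integral>\<omega>. h \<omega> \<partial>field_product (\<beta> *\<^sub>R x)) \<partial>lborel)"
proof -
  interpret prob_space PP by (rule prob_space_PP)
  interpret P: pair_sigma_finite PP "lborel :: (real^2) measure" ..
  \<comment> \<open>With Gaussian parameter n \<beta> and linear term \<beta> times the total spin
    s, the completed square is exactly the Gibbs exponent \<beta> |s|^2 / (2 n).\<close>
  define a where "a = real n * \<beta>"
  have a: "a > 0" using assms by (simp add: a_def)
  define S where "S \<omega> = \<beta> *\<^sub>R (\<Sum>k<n. \<omega> k)" for \<omega> :: "nat \<Rightarrow> real^2"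
  have [measurable]: "S \<in> borel_measurable PP" unfolding S_def by measurable
  define F where "F \<omega> x = h \<omega> * exp (- (a / 2 * (norm x)\<^sup>2) + x \<bullet> S \<omega>)" for \<omega> and x :: "real^2"
  \<comment> \<open>A majorant independent of the configuration: the total spin has norm at most n,
    so the linear term is at most a times norm x.\<close>
  define w where "w x = B * exp (- (a / 2 * (norm x)\<^sup>2) + a * norm x)" for x :: "real^2"
  have w: "integrable lborel w"
    unfolding w_def using a by (intro integrable_mult_right integrable_gaussian_linear) simp
  have [measurable]: "(\<lambda>(\<omega>, x). F \<omega> x) \<in> borel_measurable (PP \<Otimes>\<^sub>M lborel)"
    unfolding F_def by measurable
  have F_le: "norm (F \<omega> x) \<le> w x" if "\<omega> \<in> Omega" for \<omega> x
  proof -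
    have "x \<bullet> S \<omega> \<le> \<beta> * (norm x * real n)"
      unfolding S_def using inner_sum_Omega_le[OF that, of x n] \<beta> by simp
    then have "x \<bullet> S \<omega> \<le> a * norm x" by (simp add: a_def mult_ac)
    then show ?thesis
      unfolding F_def w_def norm_mult using B[OF that] by (intro mult_mono) auto
  qed
  have "integrable (PP \<Otimes>\<^sub>M lborel) (\<lambda>(\<omega>, x). w x)"
  proof (rule P.Fubini_integrable)
    have [measurable]: "w \<in> borel_measurable borel" unfolding w_def by measurable
    show "(\<lambda>(\<omega>, x). w x) \<in> borel_measurable (PP \<Otimes>\<^sub>M lborel)" by measurable
  qed (use w in auto)
  then have int: "integrable (PP \<Otimes>\<^sub>M lborel) (\<lambda>(\<omega>, x). F \<omega> x)"
  proof (rule Bochner_Integration.integrable_bound)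
    show "AE z in PP \<Otimes>\<^sub>M lborel. norm (case z of (\<omega>, x) \<Rightarrow> F \<omega> x) \<le> norm (case z of (\<omega>, x) \<Rightarrow> w x)"
      using F_le by (intro AE_I2) (force simp: space_pair_measure intro: order_trans[OF _ abs_ge_self])
  qed measurable
  have "(\<integral>x. F \<omega> x \<partial>lborel) = h \<omega> * gibbs_weight n \<beta> \<omega> * (\<integral>x. exp (- (a / 2 * (norm (x::real^2))\<^sup>2)) \<partial>lborel)" for \<omega>
  proof -
    have "(norm (S \<omega>))\<^sup>2 / (2 * a) = \<beta> / (2 * real n) * (norm (\<Sum>k<n. \<omega> k))\<^sup>2"
      using \<beta> n by (simp add: S_def a_def power_mult_distrib power2_eq_square)
    then show ?thesis
      unfolding F_def using hubbard_stratonovich[OF a, of "S \<omega>"] by (simp add: gibbs_weight_def)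
  qed
  then have "(\<integral>\<omega>. h \<omega> * gibbs_weight n \<beta> \<omega> \<partial>PP) * (\<integral>x. exp (- (a / 2 * (norm (x::real^2))\<^sup>2)) \<partial>lborel)
      = (\<integral>\<omega>. (\<integral>x. F \<omega> x \<partial>lborel) \<partial>PP)"
    by simp
  also have "\<dots> = (\<integral>x. (\<integral>\<omega>. F \<omega> x \<partial>PP) \<partial>lborel)"
    using P.Fubini_integral[OF int] by simp
  also have "\<dots> = (\<integral>x. exp (real n * phi \<beta> (norm x)) * (\<integral>\<omega>. h \<omega> \<partial>field_product (\<beta> *\<^sub>R x)) \<partial>lborel)"
  proof (intro Bochner_Integration.integral_cong refl)
    fix x :: "real^2"
    have "(\<integral>\<omega>. F \<omega> x \<partial>PP)
        = (\<integral>\<omega>. exp (- (a / 2 * (norm x)\<^sup>2)) * (h \<omega> * exp ((\<beta> *\<^sub>R x) \<bullet> (\<Sum>k<n. \<omega> k))) \<partial>PP)"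
      unfolding F_def S_def exp_add by (simp add: mult_ac)
    also have "\<dots> = exp (- (a / 2 * (norm x)\<^sup>2)) * (bessel_I0 (norm (\<beta> *\<^sub>R x)) ^ n * (\<integral>\<omega>. h \<omega> \<partial>field_product (\<beta> *\<^sub>R x)))"
      by (simp only: integral_mult_right_zero integral_field_product_cylindrical[OF h B cyl])
    finally show "(\<integral>\<omega>. F \<omega> x \<partial>PP) = exp (real n * phi \<beta> (norm x)) * (\<integral>\<omega>. h \<omega> \<partial>field_product (\<beta> *\<^sub>R x))"
      unfolding exp_phi[OF \<beta>] a_def by simp
  qed
  finally show ?thesis by (simp add: a_def)
qed

section \<open>Normalisation of the Gibbs measures\<close>

lemma borel_measurable_gibbs_weight [measurable]: "gibbs_weight n \<beta> \<in> borel_measurable PP"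
  unfolding gibbs_weight_def by measurable

lemma gibbs_weight_nonneg: "0 \<le> gibbs_weight n \<beta> \<omega>"
  by (simp add: gibbs_weight_def)

lemma gibbs_weight_bounds:
  assumes "\<beta> > 0" "\<omega> \<in> Omega"
  shows "1 \<le> gibbs_weight n \<beta> \<omega>" "gibbs_weight n \<beta> \<omega> \<le> exp (\<beta> / (2 * real n) * (real n)\<^sup>2)"
  using assms norm_sum_Omega_le[OF assms(2), of n]
  by (auto simp: gibbs_weight_def intro!: mult_left_mono divide_right_mono power_mono)

lemma integrable_gibbs_weight:
  assumes "\<beta> > 0"
  shows "integrable PP (gibbs_weight n \<beta>)"
  using gibbs_weight_bounds[OF assms, of _ n]
  by (intro integrable_bounded_PP[OF prob_space_PP refl, where B="exp (\<beta> / (2 * real n) * (real n)\<^sup>2)"])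
     (auto simp: abs_of_nonneg[OF gibbs_weight_nonneg])

lemma partition_fun_pos:
  assumes "\<beta> > 0"
  shows "partition_fun n \<beta> > 0"
proof -
  interpret prob_space PP by (rule prob_space_PP)
  have "(\<integral>\<omega>. 1 \<partial>PP) \<le> partition_fun n \<beta>"
    unfolding partition_fun_def using integrable_gibbs_weight[OF assms] gibbs_weight_bounds(1)[OF assms]
    by (intro integral_mono) auto
  then show ?thesis using prob_space by simp
qed

lemma sets_prob_gibbs: "sets (prob_gibbs n \<beta>) = sets PP"
  by (simp add: prob_gibbs_def)

lemma integral_prob_gibbs:
  assumes "\<beta> > 0" and [measurable]: "h \<in> borel_measurable PP"
  shows "(\<integral>\<omega>. h \<omega> \<partial>prob_gibbs n \<beta>) = (\<integral>\<omega>. h \<omega> * gibbs_weight n \<beta> \<omega> \<partial>PP) / partition_fun n \<beta>"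
proof -
  have "(\<integral>\<omega>. h \<omega> \<partial>prob_gibbs n \<beta>) = (\<integral>\<omega>. (gibbs_weight n \<beta> \<omega> / partition_fun n \<beta>) *\<^sub>R h \<omega> \<partial>PP)"
    unfolding prob_gibbs_def using partition_fun_pos[OF assms(1), of n]
    by (intro integral_density) (auto simp: gibbs_weight_nonneg)
  also have "\<dots> = (\<integral>\<omega>. (h \<omega> * gibbs_weight n \<beta> \<omega>) / partition_fun n \<beta> \<partial>PP)"
    by (simp add: mult.commute)
  finally show ?thesis by simp
qed

text \<open>The case n = 0 is included: division by zero yields the weight 1, so the measure is then
  \<open>PP\<close>.\<close>

lemma prob_space_prob_gibbs:
  assumes "\<beta> > 0"
  shows "prob_space (prob_gibbs n \<beta>)"
proof (rule prob_spaceI)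
  note Z = partition_fun_pos[OF assms, of n]
  have "emeasure (prob_gibbs n \<beta>) (space (prob_gibbs n \<beta>))
      = (\<integral>\<^sup>+\<omega>. ennreal (gibbs_weight n \<beta> \<omega> / partition_fun n \<beta>) \<partial>PP)"
    using sets.top[of PP] unfolding prob_gibbs_def
    by (subst emeasure_density) (auto intro!: nn_integral_cong)
  also have "\<dots> = ennreal (\<integral>\<omega>. gibbs_weight n \<beta> \<omega> / partition_fun n \<beta> \<partial>PP)"
    using Z integrable_gibbs_weight[OF assms, of n]
    by (intro nn_integral_eq_integral) (auto simp: gibbs_weight_nonneg)
  also have "(\<integral>\<omega>. gibbs_weight n \<beta> \<omega> / partition_fun n \<beta> \<partial>PP) = 1"
    using Z by (simp add: partition_fun_def)
  finally show "emeasure (prob_gibbs n \<beta>) (space (prob_gibbs n \<beta>)) = 1" by simp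
qed

lemma integral_prob_gibbs_eq_mixture:
  assumes \<beta>: "\<beta> > 0" and n: "n > 0"
    and h: "h \<in> borel_measurable PP" "\<And>\<omega>. \<omega> \<in> Omega \<Longrightarrow> \<bar>h \<omega>\<bar> \<le> B" "cylindrical n h"
  shows "(\<integral>\<omega>. h \<omega> \<partial>prob_gibbs n \<beta>)
    = (\<integral>x. exp (real n * phi \<beta> (norm x)) * (\<integral>\<omega>. h \<omega> \<partial>field_product (\<beta> *\<^sub>R x)) \<partial>lborel)
      / (\<integral>x. exp (real n * phi \<beta> (norm (x::real^2))) \<partial>lborel)"
proof -
  define C where "C = (\<integral>x. exp (- (real n * \<beta> / 2 * (norm (x::real^2))\<^sup>2)) \<partial>lborel)"
  \<comment> \<open>Nonvanishing is all that cancellation needs: a nonnegative integrand with zero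
    integral would vanish almost everywhere, but an exponential vanishes nowhere.\<close>
  have "C \<noteq> 0"
  proof
    assume "C = 0"
    then have "AE x::real^2 in lborel. exp (- (real n * \<beta> / 2 * (norm x)\<^sup>2)) = 0"
      unfolding C_def using \<beta> n integrable_gaussian[of "real n * \<beta> / 2"]
      by (subst (asm) integral_nonneg_eq_0_iff_AE) auto
    then show False
      by (auto simp: eventually_ae_filter null_sets_def top.extremum_unique)
  qed
  have "partition_fun n \<beta> * C = (\<integral>x. exp (real n * phi \<beta> (norm (x::real^2))) \<partial>lborel)"
    using gibbs_weight_integral[OF \<beta> n, of "\<lambda>_. 1" 1]
      prob_space.prob_space[OF prob_space_field_product]
    by (simp add: C_def partition_fun_def cylindrical_def)
  moreover have "(\<integral>\<omega>. h \<omega> \<partial>prob_gibbs n \<beta>)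
      = ((\<integral>\<omega>. h \<omega> * gibbs_weight n \<beta> \<omega> \<partial>PP) * C) / (partition_fun n \<beta> * C)"
    using \<open>C \<noteq> 0\<close> by (simp add: integral_prob_gibbs[OF \<beta> h(1)])
  ultimately show ?thesis
    using gibbs_weight_integral[OF \<beta> n h] unfolding C_def by (simp only:)
qed

section \<open>Averaging over rotations\<close>

lemma rotation_eq: "rotation \<alpha> x = (x $ 1) *\<^sub>R uvec \<alpha> + (x $ 2) *\<^sub>R uvec (\<alpha> + pi / 2)"
  by (simp add: rotation_def vec_eq_iff forall_2 cos_add sin_add)

lemma continuous_on_rotation:
  "continuous_on UNIV (\<lambda>z. rotation (fst z) (snd z))"
  unfolding rotation_eq by (intro continuous_intros)

lemma abs_circle_avg_le:
  assumes g: "continuous_on UNIV g" and B: "\<And>u. \<bar>g u\<bar> \<le> B"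
  shows "\<bar>circle_avg g\<bar> \<le> B"
proof -
  interpret prob_space haar_circle by (rule prob_space_haar_circle)
  have m [measurable]: "g \<in> borel_measurable haar_circle"
    using measurable_compose[OF measurable_haar_borel borel_measurable_continuous_onI[OF g]] .
  have "B \<ge> 0" using B[of 0] by simp
  have "\<bar>\<integral>u. g u \<partial>haar_circle\<bar> \<le> (\<integral>u. \<bar>g u\<bar> \<partial>haar_circle)"
    using integral_norm_bound[of haar_circle g] by simp
  also have "\<dots> \<le> (\<integral>u. B \<partial>haar_circle)"
    using B \<open>B \<ge> 0\<close> by (intro integral_mono integrable_abs integrable_const_bound[where B=B]) auto
  finally show ?thesis
    using integral_haar_circle[OF m] prob_space by simp
qed

text \<open>Lebesgue measure and the radial factor are invariant under each rotation, so rotating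
  the argument of g leaves the integral unchanged. Averaging over the angle and exchanging the
  integrals replaces g by its mean over each circle.\<close>

lemma integral_radial_weight:
  fixes E :: "real \<Rightarrow> real" and g :: "real^2 \<Rightarrow> real"
  assumes E: "integrable lborel (\<lambda>x::real^2. E (norm x))" "E \<in> borel_measurable borel"
    and g: "continuous_on UNIV g" and B: "\<And>x. \<bar>g x\<bar> \<le> B"
  shows "(\<integral>x. E (norm x) * g x \<partial>lborel) = (\<integral>x. E (norm (x::real^2)) * circle_avg (\<lambda>u. g (norm x *\<^sub>R u)) \<partial>lborel)"
proof -
  define U where "U = uniform_measure lborel {-pi..pi}"
  interpret U: prob_space U unfolding U_def by (rule prob_space_uniform_angle)
  interpret P: pair_sigma_finite U "lborel :: (real^2) measure" ..
  have sets_U [measurable_cong]: "sets U = sets borel" by (simp add: U_def)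
  note [measurable] = E(2) borel_measurable_continuous_onI[OF g]
  have "(\<lambda>z. rotation (fst z) (snd z)) \<in> borel_measurable (borel \<Otimes>\<^sub>M borel)"
    using borel_measurable_continuous_onI[OF continuous_on_rotation] by (simp add: borel_prod)
  then have rot [measurable]: "(\<lambda>z. rotation (fst z) (snd z)) \<in> borel_measurable (U \<Otimes>\<^sub>M lborel)"
    by (simp cong: measurable_cong_sets sets_pair_measure_cong add: sets_U)
  have rot': "rotation \<theta> \<in> borel_measurable borel" for \<theta>
    using orthogonal_transformation_rotation[of \<theta>]
    by (intro borel_measurable_continuous_onI linear_continuous_on)
       (simp add: orthogonal_transformation_linear linear_conv_bounded_linear[symmetric])
  let ?F = "\<lambda>\<theta> x. E (norm x) * g (rotation \<theta> x)"
  have meas: "(\<lambda>(\<theta>, x). ?F \<theta> x) \<in> borel_measurable (U \<Otimes>\<^sub>M lborel)"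
    unfolding case_prod_unfold using measurable_compose[OF rot borel_measurable_continuous_onI[OF g]]
    by measurable
  have "integrable (U \<Otimes>\<^sub>M lborel) (\<lambda>(\<theta>, x::real^2). B * E (norm x))"
    by (rule P.Fubini_integrable) (use E in auto)
  then have int: "integrable (U \<Otimes>\<^sub>M lborel) (\<lambda>(\<theta>, x). ?F \<theta> x)"
  proof (rule Bochner_Integration.integrable_bound[OF _ meas])
    have "\<bar>g x\<bar> \<le> \<bar>B\<bar>" for x using B[of x] by simp
    then show "AE z in U \<Otimes>\<^sub>M lborel. norm (case z of (\<theta>, x) \<Rightarrow> ?F \<theta> x) \<le> norm (case z of (\<theta>, x) \<Rightarrow> B * E (norm x))"
      by (intro AE_I2) (auto simp: abs_mult mult.commute[of "\<bar>B\<bar>"] intro!: mult_left_mono)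
  qed
  have inv: "(\<integral>x. ?F \<theta> x \<partial>lborel) = (\<integral>x. E (norm x) * g x \<partial>lborel)" for \<theta>
  proof -
    have "(\<integral>x. E (norm x) * g x \<partial>lborel) = (\<integral>x. E (norm x) * g x \<partial>distr lborel borel (rotation \<theta>))"
      by (simp add: lborel_distr_orthogonal_transformation orthogonal_transformation_rotation)
    also have "\<dots> = (\<integral>x. E (norm (rotation \<theta> x)) * g (rotation \<theta> x) \<partial>lborel)"
      using rot' by (intro integral_distr) auto
    finally show ?thesis by simp
  qed
  \<comment> \<open>The inner integral does not depend on \<theta>, and \<open>U\<close> has mass
    1.\<close>
  have "(\<integral>x. E (norm x) * g x \<partial>lborel) = (\<integral>\<theta>. (\<integral>x. ?F \<theta> x \<partial>lborel) \<partial>U)"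
    by (simp add: inv U.prob_space)
  also have "\<dots> = (\<integral>x. (\<integral>\<theta>. ?F \<theta> x \<partial>U) \<partial>lborel)"
    using P.Fubini_integral[OF int] by simp
  also have "\<dots> = (\<integral>x. E (norm (x::real^2)) * circle_avg (\<lambda>u. g (norm x *\<^sub>R u)) \<partial>lborel)"
  proof (intro Bochner_Integration.integral_cong refl)
    fix x :: "real^2"
    have "continuous_on UNIV (\<lambda>\<theta>. g (rotation \<theta> x))"
      unfolding rotation_eq by (intro continuous_on_compose2[OF g] continuous_intros) auto
    then have "(\<integral>\<theta>. g (rotation \<theta> x) \<partial>U) = circle_avg (\<lambda>u. g (norm x *\<^sub>R u))"
      unfolding U_def
      using circle_avg_rotation[OF g, of x]
      by (simp only: integral_uniform_angle[OF borel_measurable_continuous_onI])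
    then show "(\<integral>\<theta>. ?F \<theta> x \<partial>U) = E (norm x) * circle_avg (\<lambda>u. g (norm x *\<^sub>R u))"
      by simp
  qed
  finally show ?thesis .
qed

lemma continuous_on_radial_avg:
  assumes g: "continuous_on UNIV g"
  shows "continuous_on UNIV (\<lambda>s. circle_avg (\<lambda>u. g (s *\<^sub>R u)))"
proof -
  have "continuous_on UNIV (\<lambda>\<theta>. g (s *\<^sub>R uvec \<theta>))" for s
    by (intro continuous_on_compose2[OF g] continuous_intros) auto
  moreover have "continuous_on UNIV (\<lambda>s. integral (cbox (-pi) pi) (\<lambda>\<theta>. g (s *\<^sub>R uvec \<theta>)))"
    unfolding case_prod_unfold
    by (intro integral_continuous_on_param) (auto simp: case_prod_unfold intro!: continuous_on_compose2[OF g] continuous_intros)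
  then have "continuous_on UNIV (\<lambda>s. 1 / (2 * pi) * integral {-pi..pi} (\<lambda>\<theta>. g (s *\<^sub>R uvec \<theta>)))"
    by (intro continuous_on_mult_left) simp
  ultimately show ?thesis
    by (simp only: circle_avg_eq_integral)
qed

lemma prob_gibbs_converges_cylindrical:
  assumes \<beta>: "\<beta> > 0" and r: "0 \<le> r" "\<And>y. y \<ge> 0 \<Longrightarrow> phi \<beta> y \<le> phi \<beta> r"
    and h: "continuous_on Omega h" "cylindrical m h"
  shows "(\<lambda>n. \<integral>\<omega>. h \<omega> \<partial>prob_gibbs n \<beta>) \<longlonglongrightarrow> (\<integral>\<omega>. h \<omega> \<partial>eta (\<beta> * r))"
proof -
  note hm = measurable_PP_of_continuous[OF h(1)]
  obtain B where B: "\<And>\<omega>. \<omega> \<in> Omega \<Longrightarrow> \<bar>h \<omega>\<bar> \<le> B"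
    using bounded_of_continuous[OF h(1)] by blast
  define g where "g x = (\<integral>\<omega>. h \<omega> \<partial>field_product (\<beta> *\<^sub>R x))" for x
  have g: "continuous_on UNIV g"
    unfolding g_def
    by (intro continuous_on_compose2[OF continuous_on_integral_field_product[OF hm B h(2)]] continuous_intros) auto
  have gB: "\<bar>g x\<bar> \<le> B" for x
    unfolding g_def by (intro abs_integral_le[OF hm B] prob_space_field_product sets_field_product)
  define G where "G s = circle_avg (\<lambda>u. g (s *\<^sub>R u))" for s
  have G: "continuous_on UNIV G"
    unfolding G_def by (rule continuous_on_radial_avg[OF g])
  have GB: "\<bar>G s\<bar> \<le> B" for s
    unfolding G_def by (intro abs_circle_avg_le gB continuous_on_compose2[OF g] continuous_intros) auto
  define V where "V x = phi \<beta> (norm x)" for x :: "real^2"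
  have V: "continuous_on UNIV V"
    unfolding V_def by (intro continuous_on_compose2[OF continuous_on_phi[of UNIV]] continuous_intros) auto
  have "(\<lambda>n. (\<integral>x. exp (real n * V x) * G (norm x) \<partial>lborel) / (\<integral>x. exp (real n * V x) \<partial>lborel)) \<longlonglongrightarrow> G r"
  proof (rule laplace_concentration[OF V])
    show "integrable lborel (\<lambda>x. exp (V x))"
      unfolding V_def by (rule integrable_exp_phi[OF \<beta>])
    show "V (r *\<^sub>R uvec 0) = phi \<beta> r" using r(1) by (simp add: V_def)
    show "V x \<le> phi \<beta> r" for x using r(2) by (simp add: V_def)
    show "(\<lambda>x::real^2. G (norm x)) \<in> borel_measurable borel"
      by (intro borel_measurable_continuous_onI continuous_on_compose2[OF G] continuous_intros) auto
    show "\<bar>G (norm x)\<bar> \<le> B" for x :: "real^2" by (rule GB)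
    fix \<epsilon> :: real assume "\<epsilon> > 0"
    then obtain \<delta> where \<delta>: "\<delta> > 0" "\<And>s. \<bar>s - r\<bar> < \<delta> \<Longrightarrow> \<bar>G s - G r\<bar> < \<epsilon>"
      using G unfolding continuous_on_iff dist_real_def by (metis UNIV_I)
    then show "\<exists>c>0. \<forall>x. V x > phi \<beta> r - c \<longrightarrow> \<bar>G (norm x) - G r\<bar> \<le> \<epsilon>"
      \<comment> \<open>Nearly maximal V forces norm x to be close to r, where continuity of the
        radial function G applies.\<close>
      using phi_near_max[OF \<beta> r \<delta>(1)] unfolding V_def by (meson less_imp_le norm_ge_zero)
  qed
  moreover have "\<forall>\<^sub>F n in sequentially. (\<integral>x. exp (real n * V x) * G (norm x) \<partial>lborel) / (\<integral>x. exp (real n * V x) \<partial>lborel)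
      = (\<integral>\<omega>. h \<omega> \<partial>prob_gibbs n \<beta>)"
    \<comment> \<open>The mixture formula needs \<open>h\<close> to depend on the first n spins
      only, and n > 0 for a genuine Gaussian.\<close>
    using eventually_ge_at_top[of "max m 1"]
  proof eventually_elim
    case (elim n)
    have "cylindrical n h" using cylindrical_mono[OF h(2)] elim by simp
    then have "(\<integral>\<omega>. h \<omega> \<partial>prob_gibbs n \<beta>)
        = (\<integral>x. exp (real n * V x) * g x \<partial>lborel) / (\<integral>x. exp (real n * V x) \<partial>lborel)"
      unfolding V_def g_def using elim by (intro integral_prob_gibbs_eq_mixture[OF \<beta> _ hm B]) auto
    also have "(\<integral>x. exp (real n * V x) * g x \<partial>lborel) = (\<integral>x. exp (real n * V x) * G (norm x) \<partial>lborel)"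
      unfolding V_def G_def
    proof (rule integral_radial_weight[where E="\<lambda>s. exp (real n * phi \<beta> s)", OF _ _ g gB])
      show "(\<lambda>s. exp (real n * phi \<beta> s)) \<in> borel_measurable borel"
        by (intro borel_measurable_continuous_onI continuous_intros continuous_on_phi)
      show "integrable lborel (\<lambda>x::real^2. exp (real n * phi \<beta> (norm x)))"
        using elim by (intro integrable_exp_scaled[OF V[unfolded V_def] integrable_exp_phi[OF \<beta>], where M="phi \<beta> r"] r(2)) auto
    qed
    finally show ?case by simp
  qed
  ultimately have "(\<lambda>n. \<integral>\<omega>. h \<omega> \<partial>prob_gibbs n \<beta>) \<longlonglongrightarrow> G r"
    by (rule Lim_transform_eventually)
  then show ?thesis
    by (simp add: integral_eta[OF h(1)] G_def g_def)
qed

lemma cylindrical_approximation: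
  fixes h :: "(nat \<Rightarrow> real^2) \<Rightarrow> real"
  assumes h: "continuous_on Omega h" and "\<epsilon> > 0"
  shows "\<exists>m h'. continuous_on Omega h' \<and> cylindrical m h' \<and> (\<forall>\<omega>\<in>Omega. \<bar>h \<omega> - h' \<omega>\<bar> \<le> \<epsilon>)"
proof -
  have "uniformly_continuous_on Omega h"
    using h compact_Omega by (rule compact_uniformly_continuous)
  then obtain d where d: "d > 0" "\<And>\<omega> \<omega>'. \<omega> \<in> Omega \<Longrightarrow> \<omega>' \<in> Omega \<Longrightarrow> dist \<omega>' \<omega> < d \<Longrightarrow> dist (h \<omega>') (h \<omega>) < \<epsilon>"
    unfolding uniformly_continuous_on_def using \<open>\<epsilon> > 0\<close> by metis
  obtain N where N: "(1 / 2) ^ N < d"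
    using d(1) real_arch_pow_inv[of d "1 / 2"] by auto
  \<comment> \<open>The product metric weighs coordinates along the enumeration
    \<open>from_nat\<close>, which need not be the identity on the naturals; \<open>m\<close>
    exceeds every index among its first N + 1 terms. Agreement there leaves a distance of at most
    (1/2)^N.\<close>
  define m where "m = Suc (Max ((from_nat :: nat \<Rightarrow> nat) ` {..N}))"
  have m: "from_nat j < m" if "j \<le> N" for j
    using that by (simp add: m_def less_Suc_eq_le)
  define trunc where "trunc \<omega> k = (if k < m then \<omega> k else uvec 0)" for \<omega> :: "nat \<Rightarrow> real^2" and k
  have trunc: "trunc \<omega> \<in> Omega" if "\<omega> \<in> Omega" for \<omega>
    using that by (auto simp: Omega_def trunc_def)
  have "continuous_on Omega (\<lambda>\<omega>. trunc \<omega> k)" for k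
    unfolding trunc_def by (cases "k < m") (auto intro!: continuous_on_product_coordinates continuous_on_subset[OF continuous_on_product_coordinates])
  then have "continuous_on Omega trunc"
    by (rule continuous_on_coordinatewise_then_product)
  then have "continuous_on Omega (\<lambda>\<omega>. h (trunc \<omega>))"
    using trunc by (intro continuous_on_compose2[OF h]) auto
  moreover have "cylindrical m (\<lambda>\<omega>. h (trunc \<omega>))"
    unfolding cylindrical_def trunc_def by (auto intro!: arg_cong[of _ _ h])
  moreover have "\<bar>h \<omega> - h (trunc \<omega>)\<bar> \<le> \<epsilon>" if \<omega>: "\<omega> \<in> Omega" for \<omega>
  proof -
    have "{dist (\<omega> (from_nat j)) (trunc \<omega> (from_nat j)) |j. j \<le> N} = {0}"
      using m by (auto simp: trunc_def)
    then have "dist \<omega> (trunc \<omega>) < d"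
      using dist_fun_le_dist_first_terms[of \<omega> "trunc \<omega>" N] N by simp
    then show ?thesis
      using d(2)[OF trunc[OF \<omega>] \<omega>] by (simp add: dist_real_def)
  qed
  ultimately show ?thesis by blast
qed

lemma prob_gibbs_weakly_converges:
  assumes \<beta>: "\<beta> > 0" and r: "0 \<le> r" "\<And>y. y \<ge> 0 \<Longrightarrow> phi \<beta> y \<le> phi \<beta> r"
  shows "weakly_converges (\<lambda>n. prob_gibbs n \<beta>) (eta (\<beta> * r))"
  unfolding weakly_converges_def
proof (intro allI impI tendstoI)
  fix h :: "(nat \<Rightarrow> real^2) \<Rightarrow> real" and e :: real
  assume h: "continuous_on Omega h" and e: "e > 0"
  obtain m h' where h': "continuous_on Omega h'" "cylindrical m h'"
    and close: "\<And>\<omega>. \<omega> \<in> Omega \<Longrightarrow> \<bar>h \<omega> - h' \<omega>\<bar> \<le> e / 3"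
    using cylindrical_approximation[OF h, of "e / 3"] e by auto
  \<comment> \<open>The error is uniform over probability measures, so it costs e/3 under the Gibbs
    measures and e/3 under the limit, leaving e/3 for the convergence itself.\<close>
  have diff: "\<bar>(\<integral>\<omega>. h \<omega> \<partial>M) - (\<integral>\<omega>. h' \<omega> \<partial>M)\<bar> \<le> e / 3" if M: "prob_space M" "sets M = sets PP" for M
  proof -
    have int: "integrable M f" if "continuous_on Omega f" for f :: "_ \<Rightarrow> real"
      using bounded_of_continuous[OF that] integrable_bounded_PP[OF M measurable_PP_of_continuous[OF that]] by blast
    have "(\<integral>\<omega>. h \<omega> \<partial>M) - (\<integral>\<omega>. h' \<omega> \<partial>M) = (\<integral>\<omega>. h \<omega> - h' \<omega> \<partial>M)"
      using int h h'(1) by simp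
    then show ?thesis
      using abs_integral_le[OF _ close M] measurable_PP_of_continuous h h'(1) by simp
  qed
  have eta: "prob_space (eta (\<beta> * r))" "sets (eta (\<beta> * r)) = sets PP"
    using is_eta_eta[of "\<beta> * r"] by (auto simp: is_eta_def)
  have "\<forall>\<^sub>F n in sequentially. dist (\<integral>\<omega>. h' \<omega> \<partial>prob_gibbs n \<beta>) (\<integral>\<omega>. h' \<omega> \<partial>eta (\<beta> * r)) < e / 3"
    using prob_gibbs_converges_cylindrical[OF \<beta> r h'] e by (intro tendstoD) auto
  then show "\<forall>\<^sub>F n in sequentially. dist (\<integral>\<omega>. h \<omega> \<partial>prob_gibbs n \<beta>) (\<integral>\<omega>. h \<omega> \<partial>eta (\<beta> * r)) < e"
  proof eventually_elim
    case (elim n)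
    then show ?case
      using diff[OF prob_space_prob_gibbs[OF \<beta>] sets_prob_gibbs, of n] diff[OF eta]
      unfolding dist_real_def by linarith
  qed
qed

theorem mainTheorem4:
  fixes \<beta> :: real
  assumes "\<beta> > 0"
  shows "\<exists>r. is_arg_max (phi \<beta>) (\<lambda>x. x \<ge> 0) r \<and>
             (\<forall>s. is_arg_max (phi \<beta>) (\<lambda>x. x \<ge> 0) s \<longrightarrow> s = r) \<and>
             weakly_converges (\<lambda>n. prob_gibbs n \<beta>) (eta (\<beta> * r))"
proof -
  have arg_max: "is_arg_max (phi \<beta>) (\<lambda>x. x \<ge> 0) s \<longleftrightarrow> 0 \<le> s \<and> (\<forall>y\<ge>0. phi \<beta> y \<le> phi \<beta> s)" for s
    by (auto simp: is_arg_max_def not_less)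
  obtain r where r: "0 \<le> r" "\<And>y. y \<ge> 0 \<Longrightarrow> phi \<beta> y \<le> phi \<beta> r"
    using phi_max_exists[OF assms] by blast
  show ?thesis
  proof (intro exI conjI allI impI)
    show "is_arg_max (phi \<beta>) (\<lambda>x. x \<ge> 0) r"
      using r by (simp add: arg_max)
    show "s = r" if "is_arg_max (phi \<beta>) (\<lambda>x. x \<ge> 0) s" for s
      using that by (intro phi_arg_max_unique[OF assms _ _ r]) (auto simp: arg_max)
    show "weakly_converges (\<lambda>n. prob_gibbs n \<beta>) (eta (\<beta> * r))"
      using assms r by (rule prob_gibbs_weakly_converges)
  qed
qed

end
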